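(* Let $V$ be a vector space of dimension $N$ over $\mathbb K\in\{\mathbb R,\mathbb C\}$, let $R:V^{\otimes 2}\to V^{\otimes 2}$ be a skew-invertible Hecke symmetry with parameter $q$, and let $\mathcal L=\mathrm{span}(L_i^{\,j})_{1\le i,j\le N}$, the operators $Q,\ \mathcal S_q,\ R_{\mathrm{End}}:\mathcal L^{\otimes 2}\to\mathcal L^{\otimes 2}$, the bracket $[\,,\,]:\mathcal L^{\otimes 2}\to\mathcal L$, given by $$[L_{\overline 1},L_{\overline 2}]=L_1R_{12}-R_{12}L_1,$$ and the algebra $\mathcal L(R_q,1)$ be as defined in the context. Then the bracket has the following properties. 1. It is skew-symmetric in the sense that $$[\,,\,]\,\mathcal S_q(L_{\overline 1}\stackrel{.}{\otimes}L_{\overline 2})=0,$$ i.e. $[\,,\,]\circ\mathcal S_q=0$ on $\mathcal L^{\otimes 2}$. 2. It satisfies the generalized Jacobi identity $$[\,,\,]\,[\,,\,]_{23}\big((X\otimes Y-Q(X\otimes Y))\otimes Z\big)=[[X,Y],Z]\qquad\text{for all }X,Y,Z\in\mathcal L;$$ otherwise stated, the adjoint action $\mathrm{ad}\,L_i^{\,j}(L_k^{\,l})=[L_i^{\,j},L_k^{\,l}]$ defines a representation of the algebra $\mathcal L(R_q,1)$ in the space $\mathcal L$. 3. It is $R_{\mathrm{End}}$-invariant, i.e. as operators on $\mathcal L^{\otimes 3}$ $$R_{\mathrm{End}}\,[\,,\,]_{23}=[\,,\,]_{12}\,(R_{\mathrm{End}})_{23}(R_{\mathrm{End}})_{12},\qquad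 R_{\mathrm{End}}\,[\,,\,]_{12}=[\,,\,]_{23}\,(R_{\mathrm{End}})_{12}(R_{\mathrm{End}})_{23}.$$
   Context: Subscripts indicate the tensor factors in which an operator acts; e.g. $R_{12}=R\otimes\mathrm{Id}$, $R_{23}=\mathrm{Id}\otimes R$ on $V^{\otimes 3}$, and $[\,,\,]_{23}(X\otimes Y\otimes Z)=X\otimes[Y,Z]$, $[\,,\,]_{12}(X\otimes Y\otimes Z)=[X,Y]\otimes Z$. A Hecke symmetry with parameter $q\in\mathbb K\setminus\{0\}$ is an invertible operator $R:V^{\otimes2}\to V^{\otimes 2}$ with $R_{12}R_{23}R_{12}=R_{23}R_{12}R_{23}$ on $V^{\otimes 3}$ and $(R-q\,\mathrm{Id})(R+q^{-1}\mathrm{Id})=0$; it is assumed that $q=1$ or $q$ is not a root of unity. Let $P$ denote the flip on $V^{\otimes 2}$. The operator $R$ is skew-invertible if there is $\Psi\in\mathrm{End}(V^{\otimes 2})$ with $\mathrm{Tr}_{(2)}R_{12}\Psi_{23}=P_{13}=\mathrm{Tr}_{(2)}\Psi_{12}R_{23}$, where $\mathrm{Tr}_{(2)}$ is the trace over the second factor. Fix a basis of $V$ and identify operators on $V^{\otimes k}$ with numerical matrices (lower indices number rows, upper indices number columns). $\mathcal L$ is the $N^2$-dimensional vector space with basis $L_i^{\,j}$, $1\le i,j\le N$, and $L=\|L_i^{\,j}\|$ is the $N\times N$ matrix with these entries. For matrices $A,B$ of equal size with entries in vector spaces, $A\stackrel{.}{\otimes}B$ denotes the matrix $(A\stackrel{.}{\otimes}B)_i^{\,j}=\sum_kA_i^{\,k}\otimes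 B_k^{\,j}$. Put $$L_1=L_{\overline 1}=L\otimes\mathrm{Id},\qquad L_{\overline{p+1}}=R_{p,p+1}L_{\overline p}R_{p,p+1}^{-1}.$$ Because $R$ is skew-invertible, the entries of $L_{\overline 1}\stackrel{.}{\otimes}L_{\overline 2}$ span $\mathcal L^{\otimes 2}$ and are in one-to-one correspondence with the basis elements $L_{i}^{\,j}\otimes L_{k}^{\,l}$, so linear maps on $\mathcal L^{\otimes 2}$ can be defined by giving their (entrywise) values on $L_{\overline 1}\stackrel{.}{\otimes}L_{\overline 2}$. In this way one defines - $[\,,\,]:\mathcal L^{\otimes 2}\to\mathcal L$ by $[L_{\overline 1},L_{\overline 2}]=L_1R_{12}-R_{12}L_1$, where $[L_{\overline 1},L_{\overline 2}]$ is the result of applying the bracket to the entries of $L_{\overline 1}\stackrel{.}{\otimes}L_{\overline 2}$; - $Q(L_{\overline 1}\stackrel{.}{\otimes}L_{\overline 2})=R_{12}^{-1}\,L_{\overline 1}\stackrel{.}{\otimes}L_{\overline 2}\,R_{12}$ (an invertible operator); - $R_{\mathrm{End}}(L_{\overline 1}\stackrel{.}{\otimes}L_{\overline 2})=L_{\overline 2}\stackrel{.}{\otimes}L_{\overline 1}$; - $\mathcal S_q=\dfrac{1}{2_q^2}\big((q^2+q^{-2})\,\mathrm{Id}+Q+Q^{-1}\big)$, where $2_q=q+q^{-1}$. The modified reflection equation algebra $\mathcal L(R_q,1)$ is the unital associative algebra generated by the elements $L_i^{\,j}$ subject to the relations $$R_{12}L_1R_{12}L_1-L_1R_{12}L_1R_{12}=R_{12}L_1-L_1R_{12}.$$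 *)

theory Defs
  imports
    "HOL-Analysis.Analysis"
    "HOL-Library.Poly_Mapping"
    "HOL-Algebra.QuotRing"
begin

section \<open>Hecke symmetries as numerical matrices\<close>

text \<open>
  A basis of \<open>V\<close> is fixed and indexed by the finite type \<open>'n\<close>, so that \<open>N = CARD('n)\<close> and
  \<open>V\<^sup>\<otimes>\<^sup>k\<close> has the index type \<open>'n \<times> \<dots> \<times> 'n\<close> (\<open>k\<close> factors, nested to the right). Lower indices
  number rows and upper indices number columns: \<open>A\<^sub>i\<^sup>j\<close> is \<open>A $ i $ j\<close>. The definitions make sense
  over any field; class \<open>real_normed_field\<close> (multiplicative norm) expresses that the ground field is
  the real or the complex numbers, its only instances up to isomorphism by Ostrowski's theorem.
\<close>

definition op12 :: "'a::zero^('n::finite \<times> 'n)^('n \<times> 'n) \<Rightarrow> 'a^('n \<times> 'n \<times> 'n)^('n \<times> 'n \<times> 'n)" where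
  "op12 A = (\<chi> x y. case (x, y) of ((i, j, k), (i', j', k')) \<Rightarrow>
     if k = k' then A $ (i, j) $ (i', j') else 0)"

definition op23 :: "'a::zero^('n::finite \<times> 'n)^('n \<times> 'n) \<Rightarrow> 'a^('n \<times> 'n \<times> 'n)^('n \<times> 'n \<times> 'n)" where
  "op23 A = (\<chi> x y. case (x, y) of ((i, j, k), (i', j', k')) \<Rightarrow>
     if i = i' then A $ (j, k) $ (j', k') else 0)"

text \<open>The result of the partial trace acts on the remaining first and third factors.\<close>

definition ptrace2 ::
    "'a::comm_monoid_add^('n::finite \<times> 'n \<times> 'n)^('n \<times> 'n \<times> 'n) \<Rightarrow> 'a^('n \<times> 'n)^('n \<times> 'n)" where
  "ptrace2 A = (\<chi> x y. case (x, y) of ((i, k), (i', k')) \<Rightarrow> \<Sum>j\<in>UNIV. A $ (i, j, k) $ (i', j, k'))"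

definition flip_matrix :: "'a::zero_neq_one^('n::finite \<times> 'n)^('n \<times> 'n)" where
  "flip_matrix = (\<chi> x y. if y = (snd x, fst x) then 1 else 0)"

definition hecke_symmetry :: "'a::field \<Rightarrow> 'a^('n::finite \<times> 'n)^('n \<times> 'n) \<Rightarrow> bool" where
  "hecke_symmetry q R \<longleftrightarrow>
     q \<noteq> 0 \<and> (q = 1 \<or> (\<forall>m::nat. m > 0 \<longrightarrow> q ^ m \<noteq> 1)) \<and>
     invertible R \<and>
     op12 R ** op23 R ** op12 R = op23 R ** op12 R ** op23 R \<and>
     (R - mat q) ** (R + mat (inverse q)) = 0"

definition skew_invertible :: "'a::field^('n::finite \<times> 'n)^('n \<times> 'n) \<Rightarrow> bool" where
  "skew_invertible R \<longleftrightarrow>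
     (\<exists>\<Psi>. ptrace2 (op12 R ** op23 \<Psi>) = flip_matrix \<and> ptrace2 (op12 \<Psi> ** op23 R) = flip_matrix)"

section \<open>Tensor powers of coordinate spaces\<close>

text \<open>The tensor product of \<open>'a^'b\<close> and \<open>'a^'c\<close> is the coordinate space \<open>'a^('b \<times> 'c)\<close>.\<close>

definition tensor :: "'a::times^'b::finite \<Rightarrow> 'a^'c::finite \<Rightarrow> 'a^('b \<times> 'c)" (infixr "\<otimes>\<^sub>t" 75) where
  "x \<otimes>\<^sub>t y = (\<chi> p. x $ fst p * y $ snd p)"

definition assoc :: "'a^(('b::finite \<times> 'c::finite) \<times> 'd::finite) \<Rightarrow> 'a^('b \<times> 'c \<times> 'd)" where
  "assoc t = (\<chi> x. case x of (b, c, d) \<Rightarrow> t $ ((b, c), d))"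

text \<open>For a linear map \<open>f\<close>, \<open>map_right f\<close> is \<open>Id \<otimes> f\<close> and \<open>map_left f\<close> is \<open>f \<otimes> Id\<close>.\<close>

definition map_right :: "('a^'c::finite \<Rightarrow> 'a^'e::finite) \<Rightarrow> 'a^('b::finite \<times> 'c) \<Rightarrow> 'a^('b \<times> 'e)" where
  "map_right f t = (\<chi> x. case x of (b, e) \<Rightarrow> f (\<chi> c. t $ (b, c)) $ e)"

definition map_left ::
    "('a^('b::finite \<times> 'c::finite) \<Rightarrow> 'a^'e::finite) \<Rightarrow> 'a^('b \<times> 'c \<times> 'd::finite) \<Rightarrow> 'a^('e \<times> 'd)" where
  "map_left f t = (\<chi> y. case y of (e, d) \<Rightarrow> f (\<chi> x. case x of (b, c) \<Rightarrow> t $ (b, c, d)) $ e)"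

abbreviation lin :: "('a::field^'b::finite \<Rightarrow> 'a^'c::finite) \<Rightarrow> bool" where
  "lin f \<equiv> Vector_Spaces.linear (*s) (*s) f"

lemma assoc_tensor: "assoc ((x \<otimes>\<^sub>t y) \<otimes>\<^sub>t z) = (x :: 'a::semigroup_mult^_) \<otimes>\<^sub>t y \<otimes>\<^sub>t z"
  by (auto simp: assoc_def tensor_def vec_eq_iff mult.assoc)

lemma map_right_tensor:
  assumes "lin f"
  shows "map_right f (x \<otimes>\<^sub>t y) = x \<otimes>\<^sub>t f y"
proof -
  have *: "(\<chi> c. (x \<otimes>\<^sub>t y) $ (b, c)) = x $ b *s y" for b
    by (simp add: tensor_def vec_eq_iff)
  have "f (c *s y) = c *s f y" for c
    using assms by (simp add: Vector_Spaces.linear_iff)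
  then have "map_right f (x \<otimes>\<^sub>t y) $ (b, e) = (x \<otimes>\<^sub>t f y) $ (b, e)" for b e
    unfolding map_right_def by (simp add: *) (simp add: tensor_def)
  then show ?thesis
    by (auto simp: vec_eq_iff)
qed

lemma map_left_tensor:
  assumes "lin f"
  shows "map_left f (x \<otimes>\<^sub>t y \<otimes>\<^sub>t z) = f (x \<otimes>\<^sub>t y) \<otimes>\<^sub>t z"
proof -
  have *: "(\<chi> u. case u of (b, c) \<Rightarrow> (x \<otimes>\<^sub>t y \<otimes>\<^sub>t z) $ (b, c, d)) = z $ d *s (x \<otimes>\<^sub>t y)" for d
    by (auto simp: tensor_def vec_eq_iff)
  have "f (c *s (x \<otimes>\<^sub>t y)) = c *s f (x \<otimes>\<^sub>t y)" for c
    using assms by (simp add: Vector_Spaces.linear_iff)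
  then have "map_left f (x \<otimes>\<^sub>t y \<otimes>\<^sub>t z) $ (e, d) = (f (x \<otimes>\<^sub>t y) \<otimes>\<^sub>t z) $ (e, d)" for e d
    unfolding map_left_def by (simp add: *) (simp add: tensor_def)
  then show ?thesis
    by (auto simp: vec_eq_iff)
qed

section \<open>Matrices with entries in vector spaces\<close>

definition mult_num_left :: "'a::field^'i::finite^'i \<Rightarrow> ('a^'w::finite)^'i^'i \<Rightarrow> ('a^'w)^'i^'i" where
  "mult_num_left A M = (\<chi> i j. \<Sum>k\<in>UNIV. A $ i $ k *s M $ k $ j)"

definition mult_num_right :: "('a::field^'w::finite)^'i::finite^'i \<Rightarrow> 'a^'i^'i \<Rightarrow> ('a^'w)^'i^'i" where
  "mult_num_right M A = (\<chi> i j. \<Sum>k\<in>UNIV. A $ k $ j *s M $ i $ k)"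

definition dot_tensor ::
    "('a::field^'v::finite)^'i::finite^'i \<Rightarrow> ('a^'w::finite)^'i^'i \<Rightarrow> ('a^('v \<times> 'w))^'i^'i" where
  "dot_tensor A B = (\<chi> i j. \<Sum>k\<in>UNIV. A $ i $ k \<otimes>\<^sub>t B $ k $ j)"

text \<open>\<open>M \<otimes> Id\<close> on \<open>V \<otimes> V\<close>; the entries of \<open>M\<close> may lie in a vector space or in an algebra.\<close>

definition ext_id :: "'b::zero^'n::finite^'n \<Rightarrow> 'b^('n \<times> 'n)^('n \<times> 'n)" where
  "ext_id M = (\<chi> x y. if snd x = snd y then M $ fst x $ fst y else 0)"

section \<open>The bracket and the operators on the tensor square\<close>

text \<open>\<open>\<L>\<close> is the coordinate space \<open>'a^('n \<times> 'n)\<close>, with standard basis \<open>L\<^sub>i\<^sup>j = axis (i, j) 1\<close>.\<close>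

definition L_mat :: "('a::field^('n::finite \<times> 'n))^'n^'n" where
  "L_mat = (\<chi> i j. axis (i, j) 1)"

definition L1 :: "('a::field^('n::finite \<times> 'n))^('n \<times> 'n)^('n \<times> 'n)" where
  "L1 = ext_id L_mat"

definition L2 :: "'a::field^('n::finite \<times> 'n)^('n \<times> 'n) \<Rightarrow> ('a^('n \<times> 'n))^('n \<times> 'n)^('n \<times> 'n)" where
  "L2 R = mult_num_right (mult_num_left R L1) (matrix_inv R)"

text \<open>
  The linear map taking the entries of \<open>L\<^sub>1 \<otimes> L\<^sub>2\<close> (matrix product) to the corresponding entries of
  \<open>M\<close>. It exists uniquely for skew-invertible \<open>R\<close>, since those entries then form a basis of the
  tensor square of \<open>\<L>\<close>.
\<close>

definition lin_by_values ::
    "'a::field^('n::finite \<times> 'n)^('n \<times> 'n) \<Rightarrow> ('a^'w::finite)^('n \<times> 'n)^('n \<times> 'n) \<Rightarrow>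
     'a^(('n \<times> 'n) \<times> ('n \<times> 'n)) \<Rightarrow> 'a^'w" where
  "lin_by_values R M = (THE f. lin f \<and> map_matrix f (dot_tensor L1 (L2 R)) = M)"

definition bracket ::
    "'a::field^('n::finite \<times> 'n)^('n \<times> 'n) \<Rightarrow> 'a^(('n \<times> 'n) \<times> ('n \<times> 'n)) \<Rightarrow> 'a^('n \<times> 'n)" where
  "bracket R = lin_by_values R (mult_num_right L1 R - mult_num_left R L1)"

definition Q_op ::
    "'a::field^('n::finite \<times> 'n)^('n \<times> 'n) \<Rightarrow>
     'a^(('n \<times> 'n) \<times> ('n \<times> 'n)) \<Rightarrow> 'a^(('n \<times> 'n) \<times> ('n \<times> 'n))" where
  "Q_op R = lin_by_values R
     (mult_num_right (mult_num_left (matrix_inv R) (dot_tensor L1 (L2 R))) R)"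

definition R_End ::
    "'a::field^('n::finite \<times> 'n)^('n \<times> 'n) \<Rightarrow>
     'a^(('n \<times> 'n) \<times> ('n \<times> 'n)) \<Rightarrow> 'a^(('n \<times> 'n) \<times> ('n \<times> 'n))" where
  "R_End R = lin_by_values R (dot_tensor (L2 R) L1)"

definition S_op ::
    "'a::field \<Rightarrow> 'a^('n::finite \<times> 'n)^('n \<times> 'n) \<Rightarrow>
     'a^(('n \<times> 'n) \<times> ('n \<times> 'n)) \<Rightarrow> 'a^(('n \<times> 'n) \<times> ('n \<times> 'n))" where
  "S_op q R x = (1 / (q + inverse q)\<^sup>2) *s
     ((q\<^sup>2 + (inverse q)\<^sup>2) *s x + Q_op R x + inv_into UNIV (Q_op R) x)"

text \<open>
  The operators on the tensor cube of \<open>\<L>\<close>. The map \<open>assoc\<close> is needed for \<open>(R\<^sub>E\<^sub>n\<^sub>d)\<^sub>1\<^sub>2\<close> because its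
  first two output factors come as one pair.
\<close>

abbreviation bracket12 where "bracket12 R \<equiv> map_left (bracket R)"
abbreviation bracket23 where "bracket23 R \<equiv> map_right (bracket R)"
abbreviation R_End12 where "R_End12 R \<equiv> assoc \<circ> map_left (R_End R)"
abbreviation R_End23 where "R_End23 R \<equiv> map_right (R_End R)"

section \<open>The modified reflection equation algebra\<close>

text \<open>
  The free unital algebra is the monoid algebra of the free monoid; lists are wrapped in a
  datatype only to obtain the additively written monoid required by the convolution product on
  \<open>poly_mapping\<close>.
\<close>

datatype 'g free_mon = Free_Mon (letters: "'g list")

instantiation free_mon :: (type) monoid_add
begin

definition "0 = Free_Mon []"
definition "v + w = Free_Mon (letters v @ letters w)"

instance
  by standard (simp_all add: zero_free_mon_def plus_free_mon_def)

end

type_synonym ('a, 'g) free_alg = "'g free_mon \<Rightarrow>\<^sub>0 'a"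

definition free_alg_ring :: "('a::ring_1, 'g) free_alg ring" where
  "free_alg_ring = \<lparr>carrier = UNIV, monoid.mult = (*), one = 1, ring.zero = 0, add = (+)\<rparr>"

definition scalar :: "'a::zero \<Rightarrow> ('a, 'g) free_alg" where
  "scalar c = Poly_Mapping.single 0 c"

definition gen :: "'g \<Rightarrow> ('a::zero_neq_one, 'g) free_alg" where
  "gen g = Poly_Mapping.single (Free_Mon [g]) 1"

definition mrea_defect ::
    "'a::field^('n::finite \<times> 'n)^('n \<times> 'n) \<Rightarrow> (('a, 'n \<times> 'n) free_alg)^('n \<times> 'n)^('n \<times> 'n)" where
  "mrea_defect R =
     (let R' = map_matrix scalar R; L = ext_id (\<chi> i j. gen (i, j))
      in (R' ** L ** R' ** L - L ** R' ** L ** R') - (R' ** L - L ** R'))"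

definition mrea_ideal ::
    "'a::field^('n::finite \<times> 'n)^('n \<times> 'n) \<Rightarrow> ('a, 'n \<times> 'n) free_alg set" where
  "mrea_ideal R = genideal free_alg_ring {mrea_defect R $ x $ y | x y. True}"

definition mrea :: "'a::field^('n::finite \<times> 'n)^('n \<times> 'n) \<Rightarrow> ('a, 'n \<times> 'n) free_alg set ring" where
  "mrea R = free_alg_ring Quot mrea_ideal R"

definition mrea_class ::
    "'a::field^('n::finite \<times> 'n)^('n \<times> 'n) \<Rightarrow> ('a, 'n \<times> 'n) free_alg \<Rightarrow> ('a, 'n \<times> 'n) free_alg set" where
  "mrea_class R x = mrea_ideal R +>\<^bsub>free_alg_ring\<^esub> x"

definition End_ring :: "('a::field^'w::finite \<Rightarrow> 'a^'w) ring" where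
  "End_ring = \<lparr>carrier = {f. lin f}, monoid.mult = (\<circ>), one = id,
     ring.zero = (\<lambda>_. 0), add = (\<lambda>f g x. f x + g x)\<rparr>"

text \<open>
  A representation of \<open>mrea R\<close> as a unital algebra over the field: a unital ring homomorphism into
  the linear endomorphisms which is linear, i.e. sends the class of each scalar \<open>c\<close> to \<open>c Id\<close>.
\<close>

definition is_representation ::
    "'a::field^('n::finite \<times> 'n)^('n \<times> 'n) \<Rightarrow>
     (('a, 'n \<times> 'n) free_alg set \<Rightarrow> 'a^'w::finite \<Rightarrow> 'a^'w) \<Rightarrow> bool" where
  "is_representation R \<rho> \<longleftrightarrow>
     \<rho> \<in> ring_hom (mrea R) End_ring \<and> (\<forall>c. \<rho> (mrea_class R (scalar c)) = (\<lambda>x. c *s x))"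

end

theory Submission
  imports Defs
begin

text \<open>
  The idea is to treat matrices whose entries lie in a tensor power of \<open>\<L>\<close> as a bimodule over the
  numerical matrices, and to compute with whole matrices instead of with elements of \<open>\<L>\<close>. A linear map
  applied to all entries commutes with both actions, so an identity between linear maps becomes an
  identity between words in \<open>R\<^sub>1\<^sub>2\<close>, \<open>R\<^sub>2\<^sub>3\<close>, their inverses and the copies \<open>l1\<close>, \<open>l2\<close>, \<open>l3\<close> of
  \<open>L\<close> on three tensor factors.

  This is legitimate because the entries of \<open>l1 \<otimes> l2\<close> and of \<open>l1 \<otimes> l2 \<otimes> l3\<close> span the tensor square
  and the tensor cube (\<open>ext_pair\<close>, \<open>ext_triple\<close>). Multiplying \<open>L1 \<otimes> L2\<close> by \<open>R\<close> on the right
  gives \<open>L1 R \<otimes> L1\<close>, whose entries are obtained from the basis tensors by the matrix \<open>R\<close> with its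
  indices regrouped. Skew-invertibility says precisely that the regrouped matrix is invertible, with
  inverse a regrouping of \<open>\<Psi>\<close>. The same fact gives the existence of linear maps with prescribed values
  on \<open>L1 \<otimes> L2\<close>, hence the defining equations of the bracket, of \<open>Q\<close> and of \<open>R_End\<close>.

  By the braid relation, conjugation by \<open>R\<^sub>1\<^sub>2 R\<^sub>2\<^sub>3\<close> takes \<open>l1, l2\<close> to \<open>l2, l3\<close>, and conjugation by
  \<open>R\<^sub>2\<^sub>3\<close> takes \<open>l1, l2\<close> to \<open>l1, l3\<close>. So the defining values on \<open>l1 \<otimes> l2\<close> determine those on
  \<open>l2 \<otimes> l3\<close> and \<open>l1 \<otimes> l3\<close>. In particular \<open>R_End\<close> exchanges the two factors in each of the three
  cases, and the bracket of \<open>l2\<close> and \<open>l3\<close> is the commutator of \<open>l2\<close> with \<open>R\<^sub>2\<^sub>3\<close>. Invariance under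
  \<open>R_End\<close> follows, because \<open>l1\<close> commutes with \<open>R\<^sub>2\<^sub>3\<close> and \<open>l3\<close> commutes with \<open>R\<^sub>1\<^sub>2\<close>.

  Skew-symmetry reflects that a commutator \<open>B = L1 R - R L1\<close> is off-diagonal with respect to the
  eigenspaces of \<open>R\<close>. The two eigenvalues have product \<open>-1\<close>, so \<open>R B R = - B\<close>; therefore conjugation
  by \<open>R\<close> and by its inverse act on \<open>B\<close> as multiplication by \<open>- R\<^sup>2\<close> and \<open>- R\<^sup>-\<^sup>2\<close>, and
  \<open>R\<^sup>2 + R\<^sup>-\<^sup>2\<close> is the scalar \<open>q\<^sup>2 + q\<^sup>-\<^sup>2\<close>. The Jacobi identity becomes an identity of words, verified
  in \<open>jacobi_matrix\<close> from the braid relation and the fact that \<open>R - R\<^sup>-\<^sup>1\<close> is scalar. With its last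
  argument fixed and multiplied by \<open>R\<close> on both sides, the Jacobi identity is the relation of the modified
  reflection equation algebra for the operators \<open>ad L\<close>, so the adjoint action of the free algebra
  descends to the quotient.
\<close>

section \<open>Finite sums, tensors and numerical matrices\<close>

lemma sum_UNIV_pair:
  "(\<Sum>x\<in>UNIV. f x) = (\<Sum>i\<in>UNIV. \<Sum>y\<in>UNIV. f (i, y))"
  for f :: "'b::finite \<times> 'c::finite \<Rightarrow> 'd::comm_monoid_add"
  by (simp add: sum.cartesian_product flip: UNIV_Times_UNIV)

lemma sum_UNIV_if:
  "(\<Sum>x\<in>UNIV. if P then f x else 0) = (if P then \<Sum>x\<in>UNIV. f x else 0)"
  for f :: "'b::finite \<Rightarrow> 'd::comm_monoid_add"
  by simp

lemma vec_scale_sum: "(c::'a::field) *s (sum f A :: 'a^'n::finite) = (\<Sum>i\<in>A. c *s f i)"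
  by (simp add: vec_eq_iff sum_distrib_left)

lemma tensor_add_left: "((x::'a::field^_) + y) \<otimes>\<^sub>t z = x \<otimes>\<^sub>t z + y \<otimes>\<^sub>t z"
  and tensor_add_right: "(z::'a::field^_) \<otimes>\<^sub>t (x + y) = z \<otimes>\<^sub>t x + z \<otimes>\<^sub>t y"
  and tensor_scale_left: "(c *s (x::'a::field^_)) \<otimes>\<^sub>t z = c *s (x \<otimes>\<^sub>t z)"
  and tensor_scale_right: "(z::'a::field^_) \<otimes>\<^sub>t (c *s x) = c *s (z \<otimes>\<^sub>t x)"
  and tensor_sum_left: "sum g A \<otimes>\<^sub>t (z::'a::field^_) = (\<Sum>i\<in>A. g i \<otimes>\<^sub>t z)"
  and tensor_sum_right: "(z::'a::field^_) \<otimes>\<^sub>t sum g A = (\<Sum>i\<in>A. z \<otimes>\<^sub>t g i)"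
  and tensor_zero_left: "0 \<otimes>\<^sub>t (z::'a::field^_) = 0"
  and tensor_zero_right: "(z::'a::field^_) \<otimes>\<^sub>t 0 = 0"
  by (simp_all add: tensor_def vec_eq_iff algebra_simps sum_distrib_left sum_distrib_right)

lemma if_products:
  "(if P then a else 0) * (b::'a::field) = (if P then a * b else 0)"
  "b * (if P then a else 0) = (if P then b * a else 0)"
  "(if P then b else 0) *s (v::'a^'n) = (if P then b *s v else 0)"
  "b *s (if P then v else 0) = (if P then b *s v else 0)"
  "(if P then v else 0) \<otimes>\<^sub>t (w::'a^'m) = (if P then v \<otimes>\<^sub>t w else 0)"
  "w \<otimes>\<^sub>t (if P then v else 0) = (if P then w \<otimes>\<^sub>t v else 0)"
  by (simp_all add: tensor_zero_left tensor_zero_right)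

lemma sum4_swap:
  "(\<Sum>a\<in>A. \<Sum>b\<in>B. \<Sum>c\<in>C. \<Sum>d\<in>D. g a b c d) = (\<Sum>c\<in>C. \<Sum>d\<in>D. \<Sum>a\<in>A. \<Sum>b\<in>B. g a b c d)"
  for g :: "_ \<Rightarrow> _ \<Rightarrow> _ \<Rightarrow> _ \<Rightarrow> 'z::comm_monoid_add"
proof -
  have "(\<Sum>a\<in>A. \<Sum>b\<in>B. \<Sum>c\<in>C. \<Sum>d\<in>D. g a b c d) = (\<Sum>a\<in>A. \<Sum>c\<in>C. \<Sum>b\<in>B. \<Sum>d\<in>D. g a b c d)"
    by (intro sum.cong refl sum.swap)
  also have "\<dots> = (\<Sum>c\<in>C. \<Sum>a\<in>A. \<Sum>b\<in>B. \<Sum>d\<in>D. g a b c d)"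
    by (rule sum.swap)
  also have "\<dots> = (\<Sum>c\<in>C. \<Sum>a\<in>A. \<Sum>d\<in>D. \<Sum>b\<in>B. g a b c d)"
    by (intro sum.cong refl sum.swap)
  also have "\<dots> = (\<Sum>c\<in>C. \<Sum>d\<in>D. \<Sum>a\<in>A. \<Sum>b\<in>B. g a b c d)"
    by (intro sum.cong refl sum.swap)
  finally show ?thesis .
qed

lemma double_delta:
  fixes X :: "'n::finite \<Rightarrow> 'n \<Rightarrow> 'a::field^'w::finite"
  shows "(\<Sum>s\<in>UNIV. \<Sum>v\<in>UNIV. (if s = s' \<and> v' = v then 1 else 0) *s X s v) = X s' v'"
proof -
  have "(if s = s' \<and> v' = v then 1 else 0) *s X s v =
      (if s = s' then (if v' = v then X s v else 0) else 0)" for s v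
    by simp
  then show ?thesis
    by (simp add: sum_UNIV_if)
qed

lemma matrix_inv_works:
  fixes A :: "'a::semiring_1^'n^'n"
  assumes "invertible A"
  shows "A ** matrix_inv A = mat 1" "matrix_inv A ** A = mat 1"
proof -
  have "\<exists>A'. A ** A' = mat 1 \<and> A' ** A = mat 1"
    using assms unfolding invertible_def by simp
  from someI_ex[OF this] show "A ** matrix_inv A = mat 1" "matrix_inv A ** A = mat 1"
    unfolding matrix_inv_def by simp_all
qed

lemma matrix_diff_ldistrib: "A ** (B - C) = A ** B - A ** (C :: 'a::field^'n^'m)"
  and matrix_diff_rdistrib: "(B - C) ** D = B ** D - C ** (D :: 'a::field^'m^'n)"
  by (simp_all add: vec_eq_iff matrix_matrix_mult_def algebra_simps sum_subtractf)

section \<open>Matrices with vector entries as a bimodule\<close>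

notation mult_num_left (infixr "\<rightharpoonup>" 71)
notation mult_num_right (infixl "\<leftharpoonup>" 70)
notation dot_tensor (infixr "\<odot>\<^sub>t" 72)

lemma matrix_eqI: "(\<And>i j. M $ i $ j = N $ i $ j) \<Longrightarrow> M = N"
  by (simp add: vec_eq_iff)

lemma left_assoc: "A \<rightharpoonup> B \<rightharpoonup> M = (A ** B) \<rightharpoonup> M"
  by (simp add: mult_num_left_def matrix_matrix_mult_def vec_eq_iff sum_distrib_left
      sum_distrib_right mult.assoc) (intro allI, rule sum.swap)

lemma right_assoc: "M \<leftharpoonup> A \<leftharpoonup> B = M \<leftharpoonup> (A ** B)"
  by (simp add: mult_num_right_def matrix_matrix_mult_def vec_eq_iff sum_distrib_left
      sum_distrib_right ac_simps) (intro allI, rule sum.swap)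

lemma left_right: "(A \<rightharpoonup> M) \<leftharpoonup> B = A \<rightharpoonup> (M \<leftharpoonup> B)"
  by (simp add: mult_num_right_def mult_num_left_def vec_eq_iff sum_distrib_left ac_simps)
    (intro allI, rule sum.swap)

lemma left_one: "mat 1 \<rightharpoonup> M = M"
  by (simp add: mult_num_left_def mat_def vec_eq_iff if_distrib if_distribR sum.delta cong: if_cong)

lemma right_one: "M \<leftharpoonup> mat 1 = M"
  by (simp add: mult_num_right_def mat_def vec_eq_iff if_distrib if_distribR sum.delta' cong: if_cong)

lemma left_add: "A \<rightharpoonup> (M + N) = A \<rightharpoonup> M + A \<rightharpoonup> N"
  and left_diff: "A \<rightharpoonup> (M - N) = A \<rightharpoonup> M - A \<rightharpoonup> N"
  and right_add: "(M + N) \<leftharpoonup> A = M \<leftharpoonup> A + N \<leftharpoonup> A"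
  and right_diff: "(M - N) \<leftharpoonup> A = M \<leftharpoonup> A - N \<leftharpoonup> A"
  by (simp_all add: mult_num_left_def mult_num_right_def vec_eq_iff algebra_simps sum.distrib sum_subtractf)

lemma dot_left: "(A \<rightharpoonup> M) \<odot>\<^sub>t N = A \<rightharpoonup> (M \<odot>\<^sub>t N)"
  by (simp add: mult_num_left_def dot_tensor_def tensor_def vec_eq_iff sum_distrib_left
      sum_distrib_right mult.assoc) (intro allI, rule sum.swap)

lemma dot_right: "M \<odot>\<^sub>t (N \<leftharpoonup> A) = (M \<odot>\<^sub>t N) \<leftharpoonup> A"
  by (simp add: mult_num_right_def dot_tensor_def tensor_def vec_eq_iff sum_distrib_left
      sum_distrib_right ac_simps) (intro allI, rule sum.swap)

text \<open>
  The product is balanced over the numerical matrices: a matrix standing between two factors may be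
  attached to either of them. Together with \<open>dot_left\<close> and \<open>dot_right\<close> this makes words in matrices
  and copies of \<open>L\<close> behave as in an associative algebra.
\<close>

lemma dot_middle: "(M \<leftharpoonup> A) \<odot>\<^sub>t N = M \<odot>\<^sub>t (A \<rightharpoonup> N)"
  by (simp add: mult_num_right_def mult_num_left_def dot_tensor_def tensor_def vec_eq_iff
      sum_distrib_left sum_distrib_right ac_simps) (intro allI, rule sum.swap)

lemma dot_diff_left: "(M - M') \<odot>\<^sub>t N = M \<odot>\<^sub>t N - M' \<odot>\<^sub>t N"
  and dot_diff_right: "M \<odot>\<^sub>t (N - N') = M \<odot>\<^sub>t N - M \<odot>\<^sub>t N'"
  by (simp_all add: dot_tensor_def tensor_def vec_eq_iff algebra_simps sum_subtractf)

lemma mat_commutes: "mat k ** A = A ** mat k" for A :: "'a::field^'n^'n"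
  by (simp add: vec_eq_iff matrix_matrix_mult_def mat_def if_products)

lemma mat_mult_mat: "mat k ** mat l = (mat (k * l) :: 'a::field^'n^'n)"
  by (simp add: vec_eq_iff matrix_matrix_mult_def mat_def if_products)

lemma mat_add: "mat k + mat l = (mat (k + l) :: 'a::field^'n^'n)"
  and mat_diff: "mat k - mat l = (mat (k - l) :: 'a::field^'n^'n)"
  by (simp_all add: vec_eq_iff mat_def)

lemma mat_left_entry: "(mat k \<rightharpoonup> M) $ i $ j = k *s M $ i $ j"
  by (simp add: mult_num_left_def mat_def if_products)

lemma right_mat: "M \<leftharpoonup> mat k = mat k \<rightharpoonup> M"
  by (rule matrix_eqI) (simp add: mult_num_right_def mult_num_left_def mat_def if_products)

lemma add_left_action: "(A + B) \<rightharpoonup> M = A \<rightharpoonup> M + B \<rightharpoonup> M"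
  and diff_left_action: "(A - B) \<rightharpoonup> M = A \<rightharpoonup> M - B \<rightharpoonup> M"
  and add_right_action: "M \<leftharpoonup> (A + B) = M \<leftharpoonup> A + M \<leftharpoonup> B"
  and diff_right_action: "M \<leftharpoonup> (A - B) = M \<leftharpoonup> A - M \<leftharpoonup> B"
  by (simp_all add: mult_num_left_def mult_num_right_def vec_eq_iff algebra_simps sum.distrib sum_subtractf)

lemma left_minus: "A \<rightharpoonup> (- M) = - (A \<rightharpoonup> M)"
  and right_minus: "(- M) \<leftharpoonup> A = - (M \<leftharpoonup> A)"
  by (simp_all add: mult_num_left_def mult_num_right_def vec_eq_iff sum_negf)

lemma dot_conj:
  assumes "T' ** T = mat 1"
  shows "(T \<rightharpoonup> M \<leftharpoonup> T') \<odot>\<^sub>t (T \<rightharpoonup> N \<leftharpoonup> T') = T \<rightharpoonup> (M \<odot>\<^sub>t N) \<leftharpoonup> T'"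
  by (simp add: left_right dot_left dot_right dot_middle left_assoc right_assoc assms left_one)

text \<open>
  A factor that commutes with \<open>A\<close> can be pulled out of a commutator with \<open>A\<close>. The values of the
  bracket are commutators with \<open>R\<close>, so this moves the bracket past the neighbouring factor.
\<close>

lemma dot_commutator_right:
  assumes "A \<rightharpoonup> K = K \<leftharpoonup> A"
  shows "K \<odot>\<^sub>t (M \<leftharpoonup> A - A \<rightharpoonup> M) = (K \<odot>\<^sub>t M) \<leftharpoonup> A - A \<rightharpoonup> (K \<odot>\<^sub>t M)"
  by (simp only: dot_diff_right dot_right assms flip: dot_left dot_middle)

lemma dot_commutator_left:
  assumes "A \<rightharpoonup> K = K \<leftharpoonup> A"
  shows "(M \<leftharpoonup> A - A \<rightharpoonup> M) \<odot>\<^sub>t K = (M \<odot>\<^sub>t K) \<leftharpoonup> A - A \<rightharpoonup> (M \<odot>\<^sub>t K)"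
  by (simp only: dot_diff_left dot_middle assms dot_right dot_left)

section \<open>Linear maps on tensor products\<close>

lemma linD:
  assumes "lin f"
  shows "f (x + y) = f x + f y" "f (c *s x) = c *s f x" "f 0 = 0" "f (x - y) = f x - f y"
    "f (sum g A) = (\<Sum>i\<in>A. f (g i))"
proof -
  interpret f: Vector_Spaces.linear "(*s)" "(*s)" f by fact
  show "f (x + y) = f x + f y" "f (c *s x) = c *s f x" "f 0 = 0" "f (x - y) = f x - f y"
    "f (sum g A) = (\<Sum>i\<in>A. f (g i))"
    by (simp_all add: f.add f.scale f.zero f.diff f.sum)
qed

lemma linI:
  fixes f :: "'a::field^'b::finite \<Rightarrow> 'a^'c::finite"
  assumes "\<And>x y. f (x + y) = f x + f y" "\<And>c x. f (c *s x) = c *s f x"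
  shows "lin f"
  using assms by (simp add: Vector_Spaces.linear_iff vec.vector_space_axioms)

lemma lin_zero: "lin (\<lambda>x. 0)"
  by (rule linI) simp_all

lemma lin_compose: "lin f \<Longrightarrow> lin g \<Longrightarrow> lin (\<lambda>x. f (g x))"
  by (rule linI) (simp_all add: linD)

lemma lin_diff: "lin f \<Longrightarrow> lin g \<Longrightarrow> lin (\<lambda>x. f x - g x)"
  by (rule linI) (simp_all add: linD vec_eq_iff algebra_simps)

lemma lin_id: "lin (\<lambda>x. x)"
  by (rule linI) simp_all

lemma lin_assoc: "lin assoc"
  by (rule linI) (auto simp: assoc_def vec_eq_iff)

lemma lin_tensor_left: "lin (\<lambda>x. x \<otimes>\<^sub>t z)"
  by (rule linI) (simp_all add: tensor_add_left tensor_scale_left)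

lemma lin_tensor_right: "lin (\<lambda>x. z \<otimes>\<^sub>t x)"
  by (rule linI) (simp_all add: tensor_add_right tensor_scale_right)

lemma lin_map_right:
  fixes f :: "'a::field^'c::finite \<Rightarrow> 'a^'e::finite"
  assumes "lin f"
  shows "lin (map_right f :: 'a^('b::finite \<times> 'c) \<Rightarrow> _)"
proof (rule linI)
  have *: "(\<chi> c. x $ (b, c) + y $ (b, c)) = (\<chi> c. x $ (b, c)) + (\<chi> c. y $ (b, c))"
    for x y :: "'a^('b \<times> 'c)" and b
    by (simp add: vec_eq_iff)
  show "map_right f (x + y) = map_right f x + map_right f y" for x y :: "'a^('b \<times> 'c)"
    by (auto simp: map_right_def vec_eq_iff * linD(1)[OF assms])
  have *: "(\<chi> c. r * x $ (b, c)) = r *s (\<chi> c. x $ (b, c))" for r and x :: "'a^('b \<times> 'c)" and b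
    by (simp add: vec_eq_iff)
  show "map_right f (r *s x) = r *s map_right f x" for r and x :: "'a^('b \<times> 'c)"
    by (auto simp: map_right_def vec_eq_iff * linD(2)[OF assms])
qed

lemma lin_map_left:
  fixes f :: "'a::field^('b::finite \<times> 'c::finite) \<Rightarrow> 'a^'e::finite"
  assumes "lin f"
  shows "lin (map_left f :: 'a^('b \<times> 'c \<times> 'd::finite) \<Rightarrow> _)"
proof (rule linI)
  have *: "(\<chi> p. case p of (b, c) \<Rightarrow> x $ (b, c, d) + y $ (b, c, d)) =
      (\<chi> p. case p of (b, c) \<Rightarrow> x $ (b, c, d)) + (\<chi> p. case p of (b, c) \<Rightarrow> y $ (b, c, d))"
    for x y :: "'a^('b \<times> 'c \<times> 'd)" and d
    by (auto simp add: vec_eq_iff)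
  show "map_left f (x + y) = map_left f x + map_left f y" for x y :: "'a^('b \<times> 'c \<times> 'd)"
    by (auto simp: map_left_def vec_eq_iff * linD(1)[OF assms])
  have *: "(\<chi> p. case p of (b, c) \<Rightarrow> r * x $ (b, c, d)) =
      r *s (\<chi> p. case p of (b, c) \<Rightarrow> x $ (b, c, d))" for r and x :: "'a^('b \<times> 'c \<times> 'd)" and d
    by (auto simp add: vec_eq_iff)
  show "map_left f (r *s x) = r *s map_left f x" for r and x :: "'a^('b \<times> 'c \<times> 'd)"
    by (auto simp: map_left_def vec_eq_iff * linD(2)[OF assms])
qed

lemma map_left_assoc_tensor:
  assumes "lin f"
  shows "map_left f (assoc (t \<otimes>\<^sub>t z)) = f t \<otimes>\<^sub>t z"
proof -
  have *: "(\<chi> x. case x of (b, c) \<Rightarrow> assoc (t \<otimes>\<^sub>t z) $ (b, c, d)) = z $ d *s t" for d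
    by (auto simp: tensor_def assoc_def vec_eq_iff)
  have "map_left f (assoc (t \<otimes>\<^sub>t z)) $ (e, d) = (f t \<otimes>\<^sub>t z) $ (e, d)" for e d
    unfolding map_left_def by (simp add: * linD(2)[OF assms]) (simp add: tensor_def)
  then show ?thesis
    by (auto simp: vec_eq_iff)
qed

lemma tensor_basis_expansion:
  "t = (\<Sum>p\<in>UNIV. \<Sum>q\<in>UNIV. t $ (p, q) *s (axis p 1 \<otimes>\<^sub>t axis q 1))"
  for t :: "'a::field^('b::finite \<times> 'c::finite)"
proof -
  have "(axis p 1 \<otimes>\<^sub>t axis q 1 :: 'a^('b \<times> 'c)) $ (a, b) = (if p = a then if q = b then 1 else 0 else 0)"
    for p a q b
    by (simp add: tensor_def axis_def)
  then show ?thesis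
    by (simp add: vec_eq_iff if_products sum_UNIV_if)
qed

lemma lin_eq_0_if_tensors:
  fixes f :: "'a::field^('b::finite \<times> 'c::finite) \<Rightarrow> 'a^'d::finite"
  assumes "lin f" "\<And>p q. f (axis p 1 \<otimes>\<^sub>t axis q 1) = 0"
  shows "f t = 0"
proof -
  have "f t = f (\<Sum>p\<in>UNIV. \<Sum>q\<in>UNIV. t $ (p, q) *s (axis p 1 \<otimes>\<^sub>t axis q 1))"
    by (subst tensor_basis_expansion[of t]) simp
  also have "\<dots> = 0"
    by (simp add: linD[OF assms(1)] assms(2))
  finally show ?thesis .
qed

lemma map_left_action: "lin f \<Longrightarrow> map_matrix f (A \<rightharpoonup> M) = A \<rightharpoonup> map_matrix f M"
  by (rule matrix_eqI) (simp add: mult_num_left_def linD)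

lemma map_right_action: "lin f \<Longrightarrow> map_matrix f (M \<leftharpoonup> A) = map_matrix f M \<leftharpoonup> A"
  by (rule matrix_eqI) (simp add: mult_num_right_def linD)

lemma map_matrix_diff: "lin f \<Longrightarrow> map_matrix f (M - N) = map_matrix f M - map_matrix f N"
  by (rule matrix_eqI) (simp add: linD)

lemma map_matrix_compose: "map_matrix f (map_matrix g M) = map_matrix (\<lambda>x. f (g x)) M"
  by (rule matrix_eqI) simp

lemma map_dot_right:
  assumes "lin f"
  shows "map_matrix (map_right f) (M \<odot>\<^sub>t N) = M \<odot>\<^sub>t map_matrix f N"
  by (rule matrix_eqI)
    (simp add: dot_tensor_def linD(5)[OF lin_map_right[OF assms]] map_right_tensor[OF assms])

lemma map_dot_left:
  assumes "lin f"
  shows "map_matrix (map_left f) (M \<odot>\<^sub>t N \<odot>\<^sub>t K) = map_matrix f (M \<odot>\<^sub>t N) \<odot>\<^sub>t K"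
  by (rule matrix_eqI)
    (simp add: dot_tensor_def linD(5)[OF lin_map_left[OF assms]] map_left_tensor[OF assms]
      linD(5)[OF assms] tensor_sum_right tensor_sum_left, rule sum.swap)

lemma map_assoc_dot: "map_matrix assoc ((M \<odot>\<^sub>t N) \<odot>\<^sub>t K) = M \<odot>\<^sub>t N \<odot>\<^sub>t K"
  by (rule matrix_eqI)
    (simp add: dot_tensor_def linD(5)[OF lin_assoc] tensor_sum_right tensor_sum_left assoc_tensor,
      rule sum.swap)

section \<open>Operators on three factors\<close>

lemmas op_simps = op12_def op23_def ext_id_def mult_num_left_def mult_num_right_def dot_tensor_def
  matrix_matrix_mult_def mat_def sum_UNIV_pair sum_UNIV_if if_products

lemma op12_left: "op12 (A \<rightharpoonup> M) = op12 A \<rightharpoonup> op12 M"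
  by (rule matrix_eqI) (auto simp: op_simps)

lemma op12_right: "op12 (M \<leftharpoonup> A) = op12 M \<leftharpoonup> op12 A"
  by (rule matrix_eqI) (auto simp: op_simps)

lemma op12_dot: "op12 (M \<odot>\<^sub>t N) = op12 M \<odot>\<^sub>t op12 N"
  by (rule matrix_eqI) (auto simp: op_simps)

lemma op12_mult: "op12 (A ** B) = op12 A ** op12 (B::'a::field^_^_)"
  by (rule matrix_eqI) (auto simp: op_simps)

lemma op23_mult: "op23 (A ** B) = op23 A ** op23 (B::'a::field^_^_)"
  by (rule matrix_eqI) (auto simp: op_simps)

lemma op12_diff: "op12 (M - N) = op12 M - (op12 N :: 'b::group_add^_^_)"
  by (rule matrix_eqI) (auto simp: op_simps)

lemma op12_add: "op12 (M + N) = op12 M + (op12 N :: 'b::monoid_add^_^_)"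
  and op23_add: "op23 (M + N) = op23 M + (op23 N :: 'b::monoid_add^_^_)"
  by ((rule matrix_eqI, auto simp: op_simps)[1])+

lemma op12_mat: "op12 (mat k) = (mat k :: 'a::field^_^_)"
  and op23_mat: "op23 (mat k) = (mat k :: 'a::field^_^_)"
  by ((rule matrix_eqI, auto simp: op_simps split: if_splits)[1])+

lemma op23_diff: "op23 (M - N) = op23 M - (op23 N :: 'b::group_add^_^_)"
  by (rule matrix_eqI) (auto simp: op_simps)

lemma op12_map: "lin f \<Longrightarrow> map_matrix f (op12 M) = op12 (map_matrix f M)"
  by (rule matrix_eqI) (auto simp: op_simps linD)

text \<open>
  \<open>ext_id M\<close> acts in the first factor only, and \<open>A\<close> acts in the other two.
\<close>

lemma op23_commutes: "op23 A \<rightharpoonup> op12 (ext_id M) = op12 (ext_id M) \<leftharpoonup> op23 A"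
  by (rule matrix_eqI) (auto simp: op_simps)

section \<open>Skew-invertibility and the defining property of linear maps on tensors\<close>

text \<open>
  The skew-inverse \<open>\<Psi>\<close> is a parameter, so that inverting the regrouped matrix of \<open>R\<close> is an explicit
  summation against \<open>\<Psi>\<close>.
\<close>

locale braiding =
  fixes R \<Psi> :: "'a::field^('n::finite \<times> 'n)^('n \<times> 'n)"
  assumes invertible_R: "invertible R"
    and braid: "op12 R ** op23 R ** op12 R = op23 R ** op12 R ** op23 R"
    and skew1: "ptrace2 (op12 R ** op23 \<Psi>) = flip_matrix"
    and skew2: "ptrace2 (op12 \<Psi> ** op23 R) = flip_matrix"
begin

text \<open>
  The matrix whose entries serve as the basis of the tensor square on which linear maps are prescribed.
\<close>

abbreviation F where "F \<equiv> L1 \<odot>\<^sub>t L2 R"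

text \<open>
  The two partial trace equations in coordinates. Regroup \<open>R\<^sub>i\<^sub>j\<close> with upper indices \<open>i' t\<close> into a matrix
  with row index \<open>(i, i')\<close> and column index \<open>(t, j)\<close>: the first equation says that a regrouping of \<open>\<Psi>\<close>
  is its right inverse, the second one that it is its left inverse.
\<close>

lemma skew_sum1:
  "(\<Sum>j\<in>UNIV. \<Sum>t\<in>UNIV. R $ (i, j) $ (i', t) * \<Psi> $ (t, k) $ (j, k')) =
    (if i = k' \<and> k = i' then 1 else 0)"
proof -
  have "ptrace2 (op12 R ** op23 \<Psi>) $ (i, k) $ (i', k') = (if i = k' \<and> k = i' then 1 else 0)"
    unfolding skew1 by (auto simp: flip_matrix_def)
  then show ?thesis
    by (simp add: ptrace2_def op_simps)
qed

lemma skew_sum2: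
  "(\<Sum>j\<in>UNIV. \<Sum>t\<in>UNIV. \<Psi> $ (i, j) $ (i', t) * R $ (t, k) $ (j, k')) =
    (if i = k' \<and> k = i' then 1 else 0)"
proof -
  have "ptrace2 (op12 \<Psi> ** op23 R) $ (i, k) $ (i', k') = (if i = k' \<and> k = i' then 1 else 0)"
    unfolding skew2 by (auto simp: flip_matrix_def)
  then show ?thesis
    by (simp add: ptrace2_def op_simps)
qed

text \<open>
  Injectivity of the regrouped \<open>R\<close>.
\<close>

lemma skew_cancel:
  fixes X :: "'n \<Rightarrow> 'n \<Rightarrow> 'a^'w::finite"
  assumes "\<And>u j. (\<Sum>s\<in>UNIV. \<Sum>v\<in>UNIV. R $ (s, u) $ (v, j) *s X s v) = 0"
  shows "X s v = 0"
proof -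
  have "0 = (\<Sum>u\<in>UNIV. \<Sum>j\<in>UNIV. \<Psi> $ (j, v) $ (u, s) *s
      (\<Sum>s\<in>UNIV. \<Sum>v\<in>UNIV. R $ (s, u) $ (v, j) *s X s v))"
    by (simp add: assms)
  also have "\<dots> = (\<Sum>s'\<in>UNIV. \<Sum>v'\<in>UNIV. \<Sum>u\<in>UNIV. \<Sum>j\<in>UNIV.
      (R $ (s', u) $ (v', j) * \<Psi> $ (j, v) $ (u, s)) *s X s' v')"
    unfolding vec_scale_sum by (subst sum4_swap) (simp add: mult.commute)
  also have "\<dots> = (\<Sum>s'\<in>UNIV. \<Sum>v'\<in>UNIV. (if s' = s \<and> v = v' then 1 else 0) *s X s' v')"
    by (simp only: vec.scale_sum_left skew_sum1 flip: vec.scale_sum_left)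
  also have "\<dots> = X s v"
    by (rule double_delta)
  finally show ?thesis by simp
qed

definition skew_solution :: "('n \<Rightarrow> 'n \<Rightarrow> 'a^'w::finite) \<Rightarrow> 'n \<Rightarrow> 'n \<Rightarrow> 'a^'w" where
  "skew_solution Y s v = (\<Sum>u\<in>UNIV. \<Sum>j\<in>UNIV. \<Psi> $ (j, v) $ (u, s) *s Y u j)"

text \<open>
  Surjectivity of the regrouped \<open>R\<close>, with an explicit preimage.
\<close>

lemma skew_solution:
  "(\<Sum>s\<in>UNIV. \<Sum>v\<in>UNIV. R $ (s, u) $ (v, j) *s skew_solution Y s v) = Y u j"
proof -
  let ?X = "skew_solution Y"
  have "(\<Sum>s\<in>UNIV. \<Sum>v\<in>UNIV. R $ (s, u) $ (v, j) *s ?X s v) =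
      (\<Sum>u'\<in>UNIV. \<Sum>j'\<in>UNIV. \<Sum>s\<in>UNIV. \<Sum>v\<in>UNIV.
        (\<Psi> $ (j', v) $ (u', s) * R $ (s, u) $ (v, j)) *s Y u' j')"
    unfolding skew_solution_def vec_scale_sum by (subst sum4_swap) (simp add: mult.commute)
  also have "\<dots> = (\<Sum>u'\<in>UNIV. \<Sum>j'\<in>UNIV. \<Sum>v\<in>UNIV. \<Sum>s\<in>UNIV.
        (\<Psi> $ (j', v) $ (u', s) * R $ (s, u) $ (v, j)) *s Y u' j')"
    by (intro sum.cong refl sum.swap)
  also have "\<dots> = (\<Sum>u'\<in>UNIV. \<Sum>j'\<in>UNIV. (if u' = u \<and> j = j' then 1 else 0) *s Y u' j')"
    unfolding vec.scale_sum_left[symmetric] skew_sum2 by (simp add: conj_commute eq_commute)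
  also have "\<dots> = Y u j"
    by (rule double_delta)
  finally show "(\<Sum>s\<in>UNIV. \<Sum>v\<in>UNIV. R $ (s, u) $ (v, j) *s ?X s v) = Y u j" .
qed

text \<open>
  The inverse of \<open>R\<close> in \<open>L2\<close> is removed by a right multiplication. What is left between the two factors
  is \<open>R\<close> itself, so that the entries of \<open>F \<leftharpoonup> R\<close> are the basis tensors transformed by the
  regrouped \<open>R\<close>; injectivity and surjectivity of the latter give uniqueness and existence of
  linear maps with prescribed values on \<open>F\<close>.
\<close>

lemma F_R: "F \<leftharpoonup> R = L1 \<odot>\<^sub>t (R \<rightharpoonup> L1)"
  by (simp add: L2_def dot_right right_assoc matrix_inv_works[OF invertible_R] right_one)

lemma F_R_entry:
  "(F \<leftharpoonup> R) $ (a, b) $ (c, d) =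
    (\<Sum>s\<in>UNIV. \<Sum>v\<in>UNIV. R $ (s, b) $ (v, d) *s (L_mat $ a $ s \<otimes>\<^sub>t L_mat $ v $ c))"
  unfolding F_R unfolding L1_def
  by (simp add: op_simps tensor_sum_right tensor_scale_right)

lemma ext_pair:
  assumes "lin f" "lin g" "map_matrix f F = map_matrix g F"
  shows "f = g"
proof
  fix t
  let ?h = "\<lambda>t. f t - g t"
  have h: "lin ?h"
    using assms by (intro lin_diff)
  have "map_matrix ?h F = 0"
    using assms(3) by (simp add: vec_eq_iff)
  then have "map_matrix ?h (F \<leftharpoonup> R) = 0 \<leftharpoonup> R"
    by (simp add: map_right_action[OF h])
  then have *: "map_matrix ?h (F \<leftharpoonup> R) $ x $ y = 0" for x y
    by (simp add: mult_num_right_def)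
  have "?h (L_mat $ a $ s \<otimes>\<^sub>t L_mat $ v $ c) = 0" for a s v c
    by (rule skew_cancel[of "\<lambda>s v. ?h (L_mat $ a $ s \<otimes>\<^sub>t L_mat $ v $ c)"])
      (use *[of "(a, _)" "(c, _)"] in \<open>simp add: F_R_entry linD[OF h]\<close>)
  then have "?h (axis (a, s) 1 \<otimes>\<^sub>t axis (v, c) 1) = 0" for a s v c
    by (simp add: L_mat_def)
  then have "?h t = 0"
    using lin_eq_0_if_tensors[OF h] by (metis surj_pair)
  then show "f t = g t" by simp
qed

lemma ex_lin_values:
  fixes M :: "('a^'w::finite)^('n \<times> 'n)^('n \<times> 'n)"
  shows "\<exists>f. lin f \<and> map_matrix f F = M"
proof -
  define X where "X a c = skew_solution (\<lambda>u j. (M \<leftharpoonup> R) $ (a, u) $ (c, j))" for a c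
  have X: "(\<Sum>s\<in>UNIV. \<Sum>v\<in>UNIV. R $ (s, u) $ (v, j) *s X a c s v) = (M \<leftharpoonup> R) $ (a, u) $ (c, j)"
    for a c u j
    unfolding X_def by (rule skew_solution)
  define f where "f t = (\<Sum>p\<in>UNIV. t $ p *s (case p of ((a, s), (v, c)) \<Rightarrow> X a c s v))" for t
  have f: "lin f"
    by (rule linI)
      (simp_all add: f_def vec_scale_sum sum.distrib vec.scale_left_distrib)
  have "f (L_mat $ a $ s \<otimes>\<^sub>t L_mat $ v $ c) = X a c s v" for a s v c
  proof -
    have "(L_mat $ a $ s \<otimes>\<^sub>t L_mat $ v $ c :: 'a^_) $ p = (if p = ((a, s), (v, c)) then 1 else 0)" for p
      by (cases p) (auto simp: L_mat_def tensor_def axis_def)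
    then show ?thesis
      by (simp add: f_def if_products)
  qed
  then have "map_matrix f (F \<leftharpoonup> R) $ (a, b) $ (c, d) = (M \<leftharpoonup> R) $ (a, b) $ (c, d)" for a b c d
    by (simp add: F_R_entry linD[OF f] X)
  then have "map_matrix f F \<leftharpoonup> R = M \<leftharpoonup> R"
    by (intro matrix_eqI) (auto simp: map_right_action[OF f])
  then have "map_matrix f F \<leftharpoonup> R \<leftharpoonup> matrix_inv R = M \<leftharpoonup> R \<leftharpoonup> matrix_inv R"
    by simp
  then show ?thesis
    using f by (auto simp: right_assoc matrix_inv_works[OF invertible_R] right_one)
qed

lemma lin_by_values:
  fixes M :: "('a^'w::finite)^('n \<times> 'n)^('n \<times> 'n)"
  shows "lin (lin_by_values R M)" "map_matrix (lin_by_values R M) F = M"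
proof -
  have "\<exists>!f. lin f \<and> map_matrix f F = M"
    using ex_lin_values ext_pair by (metis (no_types, lifting))
  from theI'[OF this] show "lin (lin_by_values R M)" "map_matrix (lin_by_values R M) F = M"
    unfolding lin_by_values_def by simp_all
qed

text \<open>
  The letters of the words on three factors. \<open>L2 R\<close> lives on the first two factors, and \<open>l3\<close> arises from it
  by the recursion that defines the successive copies of \<open>L\<close>.
\<close>

abbreviation "a \<equiv> op12 R"
abbreviation "a' \<equiv> op12 (matrix_inv R)"
abbreviation "b \<equiv> op23 R"
abbreviation "b' \<equiv> op23 (matrix_inv R)"
abbreviation "l1 \<equiv> op12 L1"
abbreviation "l2 \<equiv> op12 (L2 R)"
abbreviation "l3 \<equiv> b \<rightharpoonup> l2 \<leftharpoonup> b'"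

lemma inverses: "a ** a' = mat 1" "a' ** a = mat 1" "b ** b' = mat 1" "b' ** b = mat 1"
  by (simp_all add: matrix_inv_works[OF invertible_R] op12_mat op23_mat flip: op12_mult op23_mult)

lemma cancel_inverses:
  "X ** a ** a' = X" "X ** a' ** a = X" "X ** b ** b' = X" "X ** b' ** b = X"
  by (simp_all add: inverses flip: matrix_mul_assoc)

lemma b_l1: "b \<rightharpoonup> l1 = l1 \<leftharpoonup> b"
  unfolding L1_def by (rule op23_commutes)

lemma l2_eq: "l2 = a \<rightharpoonup> l1 \<leftharpoonup> a'"
  by (simp add: L2_def op12_left op12_right)

lemma l1_eq: "l1 = b \<rightharpoonup> l1 \<leftharpoonup> b'"
  by (simp add: b_l1 right_assoc inverses right_one)

lemma l3_eq: "l3 = (b ** a) \<rightharpoonup> l1 \<leftharpoonup> (a' ** b')"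
  by (simp add: l2_eq left_assoc left_right right_assoc)

lemma braid_mixed: "b ** a' ** b' = a' ** b' ** a"
proof -
  have "b ** a' ** b' = a' ** b' ** (b ** a ** b) ** a' ** b'"
    by (simp add: matrix_mul_assoc cancel_inverses inverses)
  also have "\<dots> = a' ** b' ** a"
    by (simp add: matrix_mul_assoc cancel_inverses flip: braid)
  finally show ?thesis .
qed

text \<open>
  The third copy of \<open>L\<close> commutes with the operator on the first two factors, although it is built
  from \<open>l1\<close> by conjugations that involve these factors: the braid relation carries \<open>a\<close> through \<open>b a\<close>
  to \<open>b\<close>, which commutes with \<open>l1\<close>.
\<close>

lemma a_l3: "a \<rightharpoonup> l3 = l3 \<leftharpoonup> a"
proof -
  have "a \<rightharpoonup> l3 = (b ** a) \<rightharpoonup> (b \<rightharpoonup> l1) \<leftharpoonup> (a' ** b')"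
    unfolding l3_eq by (simp add: left_assoc left_right matrix_mul_assoc braid)
  also have "\<dots> = (b ** a) \<rightharpoonup> l1 \<leftharpoonup> (a' ** b' ** a)"
    by (simp add: b_l1 left_right right_assoc matrix_mul_assoc braid_mixed)
  also have "\<dots> = l3 \<leftharpoonup> a"
    unfolding l3_eq by (simp add: left_right right_assoc)
  finally show ?thesis .
qed

lemma shift_inverse: "(b' ** a') ** (a ** b) = mat 1"
  by (simp add: matrix_mul_assoc cancel_inverses inverses)

text \<open>
  Conjugation by \<open>a b\<close> raises the number of a copy of \<open>L\<close> by one.
\<close>

lemma l2_shift: "l2 = (a ** b) \<rightharpoonup> l1 \<leftharpoonup> (b' ** a')"
proof -
  have "(a ** b) \<rightharpoonup> l1 \<leftharpoonup> (b' ** a') = a \<rightharpoonup> (b \<rightharpoonup> l1 \<leftharpoonup> b') \<leftharpoonup> a'"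
    by (simp add: left_assoc left_right right_assoc)
  then show ?thesis
    by (simp only: l2_eq flip: l1_eq)
qed

lemma l3_shift: "l3 = (a ** b) \<rightharpoonup> l2 \<leftharpoonup> (b' ** a')"
proof -
  have "(a ** b) \<rightharpoonup> l2 \<leftharpoonup> (b' ** a') = (a \<rightharpoonup> l3) \<leftharpoonup> a'"
    by (simp add: left_assoc left_right right_assoc)
  also have "\<dots> = l3"
    unfolding a_l3 right_assoc[of l3] inverses right_one ..
  finally show ?thesis by simp
qed

lemma map_dot_conj: "T' ** T = mat 1 \<Longrightarrow> lin f \<Longrightarrow>
  map_matrix f ((T \<rightharpoonup> M \<leftharpoonup> T') \<odot>\<^sub>t (T \<rightharpoonup> N \<leftharpoonup> T')) = T \<rightharpoonup> map_matrix f (M \<odot>\<^sub>t N) \<leftharpoonup> T'"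
  by (simp add: dot_conj map_left_action map_right_action)

text \<open>
  Two of the three copies, taken in increasing order, are simultaneously conjugate to \<open>l1\<close> and \<open>l2\<close>, so
  a linear map on the tensor square is known on each such pair once it is known on \<open>F\<close>.
\<close>

lemma value_12: "lin f \<Longrightarrow> map_matrix f (l1 \<odot>\<^sub>t l2) = op12 (map_matrix f F)"
  by (simp add: op12_map flip: op12_dot)

lemma value_23:
  assumes "lin f"
  shows "map_matrix f (l2 \<odot>\<^sub>t l3) = (a ** b) \<rightharpoonup> op12 (map_matrix f F) \<leftharpoonup> (b' ** a')"
  unfolding l3_shift by (subst l2_shift) (simp only: map_dot_conj shift_inverse assms value_12)

lemma value_13:
  assumes "lin f"
  shows "map_matrix f (l1 \<odot>\<^sub>t l3) = b \<rightharpoonup> op12 (map_matrix f F) \<leftharpoonup> b'"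
  by (subst l1_eq) (simp only: map_dot_conj inverses assms value_12)

lemma triple_entry:
  fixes G :: "('a^'w::finite)^('n \<times> 'n)^('n \<times> 'n)"
  shows "(op12 G \<odot>\<^sub>t ((b ** a) \<rightharpoonup> l1)) $ (i, j, m) $ (i', j', m') =
      (\<Sum>t\<in>UNIV. \<Sum>u\<in>UNIV. R $ (t, m) $ (u, m') *s
        (\<Sum>s\<in>UNIV. \<Sum>v\<in>UNIV. R $ (s, u) $ (v, j') *s (G $ (i, j) $ (s, t) \<otimes>\<^sub>t L_mat $ v $ i')))"
proof -
  have "(op12 G \<odot>\<^sub>t ((b ** a) \<rightharpoonup> l1)) $ (i, j, m) $ (i', j', m') =
    (\<Sum>s\<in>UNIV. \<Sum>t\<in>UNIV. G $ (i, j) $ (s, t) \<otimes>\<^sub>t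
      (\<Sum>v\<in>UNIV. (\<Sum>u\<in>UNIV. R $ (t, m) $ (u, m') * R $ (s, u) $ (v, j')) *s L_mat $ v $ i'))"
    unfolding L1_def by (simp add: op12_def op23_def ext_id_def mult_num_left_def dot_tensor_def
        matrix_matrix_mult_def sum_UNIV_pair sum_UNIV_if if_products)
  also have "\<dots> = (\<Sum>s\<in>UNIV. \<Sum>t\<in>UNIV. \<Sum>v\<in>UNIV. \<Sum>u\<in>UNIV.
      (R $ (t, m) $ (u, m') * R $ (s, u) $ (v, j')) *s (G $ (i, j) $ (s, t) \<otimes>\<^sub>t L_mat $ v $ i'))"
    by (simp only: vec.scale_sum_left tensor_sum_right tensor_scale_right)
  also have "\<dots> = (\<Sum>s\<in>UNIV. \<Sum>v\<in>UNIV. \<Sum>t\<in>UNIV. \<Sum>u\<in>UNIV.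
      (R $ (t, m) $ (u, m') * R $ (s, u) $ (v, j')) *s (G $ (i, j) $ (s, t) \<otimes>\<^sub>t L_mat $ v $ i'))"
    by (intro sum.cong refl sum.swap)
  finally show ?thesis
    by (subst (asm) sum4_swap) (simp only: vec_scale_sum vec.scale_scale)
qed

text \<open>
  Multiplication by \<open>b a\<close> turns \<open>l3\<close> into \<open>b a l1\<close>. By \<open>triple_entry\<close> the resulting entries arise
  from the tensors of entries of \<open>F\<close> with basis vectors by applying the regrouped \<open>R\<close> twice, and both
  applications can be cancelled. The entries of \<open>F\<close> are then handled by \<open>ext_pair\<close>.
\<close>

lemma ext_triple:
  fixes f g :: "'a^(('n \<times> 'n) \<times> ('n \<times> 'n) \<times> ('n \<times> 'n)) \<Rightarrow> 'a^'w::finite"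
  assumes "lin f" "lin g"
    and eq: "map_matrix f (l1 \<odot>\<^sub>t l2 \<odot>\<^sub>t l3) = map_matrix g (l1 \<odot>\<^sub>t l2 \<odot>\<^sub>t l3)"
  shows "f = g"
proof
  fix t
  define h where "h t = f t - g t" for t
  define k where "k t = h (assoc t)" for t
  have h: "lin h"
    unfolding h_def using assms(1,2) by (intro lin_diff)
  have k: "lin k"
    unfolding k_def by (rule lin_compose[OF h lin_assoc])
  have "map_matrix k (op12 F \<odot>\<^sub>t l3) = 0"
  proof -
    have "map_matrix k (op12 F \<odot>\<^sub>t l3) = map_matrix h (map_matrix assoc ((l1 \<odot>\<^sub>t l2) \<odot>\<^sub>t l3))"
      unfolding map_matrix_compose k_def op12_dot ..
    then show ?thesis
      unfolding map_assoc_dot using eq by (simp add: vec_eq_iff h_def)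
  qed
  moreover have "op12 F \<odot>\<^sub>t ((b ** a) \<rightharpoonup> l1) = (op12 F \<odot>\<^sub>t l3) \<leftharpoonup> (b ** a)"
    unfolding l3_eq by (simp add: left_right right_assoc right_one matrix_mul_assoc cancel_inverses inverses flip: dot_right)
  ultimately have "map_matrix k (op12 F \<odot>\<^sub>t ((b ** a) \<rightharpoonup> l1)) = 0 \<leftharpoonup> (b ** a)"
    by (simp add: map_right_action[OF k])
  then have zero: "map_matrix k (op12 F \<odot>\<^sub>t ((b ** a) \<rightharpoonup> l1)) $ x $ y = 0" for x y
    by (simp add: mult_num_right_def)
  have "(\<Sum>s\<in>UNIV. \<Sum>v\<in>UNIV. R $ (s, u) $ (v, j') *s k (F $ (i, j) $ (s, t) \<otimes>\<^sub>t L_mat $ v $ i')) = 0"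
    for i j i' j' t u
    by (rule skew_cancel[of "\<lambda>t u. \<Sum>s\<in>UNIV. \<Sum>v\<in>UNIV. R $ (s, u) $ (v, j') *s
        k (F $ (i, j) $ (s, t) \<otimes>\<^sub>t L_mat $ v $ i')"])
      (use zero[of "(i, j, _)" "(i', j', _)"] in \<open>simp only: nth_map_matrix triple_entry linD[OF k]\<close>)
  then have "k (F $ (i, j) $ (s, t) \<otimes>\<^sub>t L_mat $ v $ i') = 0" for i j s t v i'
    by (rule skew_cancel)
  then have "map_matrix (\<lambda>x. k (x \<otimes>\<^sub>t L_mat $ v $ i')) F = map_matrix (\<lambda>x. 0) F" for v i'
    by (intro matrix_eqI) auto
  then have "(\<lambda>x. k (x \<otimes>\<^sub>t L_mat $ v $ i')) = (\<lambda>x. 0)" for v i'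
    by (rule ext_pair[OF lin_compose[OF k lin_tensor_left] lin_zero])
  then have "k (x \<otimes>\<^sub>t axis (v, i') 1) = 0" for x v i'
    by (simp add: L_mat_def fun_eq_iff)
  then have "h (x \<otimes>\<^sub>t y \<otimes>\<^sub>t axis p 1) = 0" for x y p
    unfolding k_def assoc_tensor[symmetric] by (cases p) simp
  then have "h (x \<otimes>\<^sub>t z) = 0" for x z
    by (rule lin_eq_0_if_tensors[OF lin_compose[OF h lin_tensor_right]])
  then have "h t = 0"
    by (rule lin_eq_0_if_tensors[OF h])
  then show "f t = g t"
    by (simp add: h_def)
qed

section \<open>The bracket, \<open>Q\<close> and \<open>R_End\<close> on the copies of \<open>L\<close>; invariance\<close>

lemma lin_bracket: "lin (bracket R)" and lin_Q: "lin (Q_op R)" and lin_R_End: "lin (R_End R)"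
  by (simp_all add: bracket_def Q_op_def R_End_def lin_by_values)

lemma bracket_F: "map_matrix (bracket R) F = L1 \<leftharpoonup> R - R \<rightharpoonup> L1"
  and Q_F: "map_matrix (Q_op R) F = matrix_inv R \<rightharpoonup> F \<leftharpoonup> R"
  and R_End_F: "map_matrix (R_End R) F = L2 R \<odot>\<^sub>t L1"
  by (simp_all add: bracket_def Q_op_def R_End_def lin_by_values)

lemma Q_inverse:
  obtains Q' where "lin Q'" "inv_into UNIV (Q_op R) = Q'"
    "map_matrix Q' F = R \<rightharpoonup> F \<leftharpoonup> matrix_inv R"
proof -
  define Q' where "Q' = lin_by_values R (R \<rightharpoonup> F \<leftharpoonup> matrix_inv R)"
  have Q': "lin Q'" "map_matrix Q' F = R \<rightharpoonup> F \<leftharpoonup> matrix_inv R"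
    unfolding Q'_def by (rule lin_by_values)+
  have "(\<lambda>x. Q_op R (Q' x)) = (\<lambda>x. x)" "(\<lambda>x. Q' (Q_op R x)) = (\<lambda>x. x)"
  proof (safe intro!: ext_pair lin_compose[OF lin_Q Q'(1)] lin_compose[OF Q'(1) lin_Q] lin_id)
    have "map_matrix (Q_op R) (map_matrix Q' F) = F" "map_matrix Q' (map_matrix (Q_op R) F) = F"
      by (simp_all only: Q_F Q' map_left_action map_right_action lin_Q
          left_assoc left_right right_assoc matrix_inv_works[OF invertible_R] left_one right_one)
    then show "map_matrix (\<lambda>x. Q_op R (Q' x)) F = map_matrix (\<lambda>x. x) F"
      "map_matrix (\<lambda>x. Q' (Q_op R x)) F = map_matrix (\<lambda>x. x) F"
      by (simp_all add: vec_eq_iff)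
  qed
  then have "inv_into UNIV (Q_op R) = Q'"
    by (intro inv_equality) (simp_all add: fun_eq_iff)
  with Q' that show ?thesis by blast
qed

lemma bracket_12: "map_matrix (bracket R) (l1 \<odot>\<^sub>t l2) = l1 \<leftharpoonup> a - a \<rightharpoonup> l1"
  by (simp only: value_12[OF lin_bracket] bracket_F op12_diff op12_left op12_right)

lemma bracket_13: "map_matrix (bracket R) (l1 \<odot>\<^sub>t l3) = b \<rightharpoonup> (l1 \<leftharpoonup> a - a \<rightharpoonup> l1) \<leftharpoonup> b'"
  by (simp only: value_13[OF lin_bracket] bracket_F op12_diff op12_left op12_right)

text \<open>
  Conjugation by \<open>a b\<close> sends \<open>a\<close> to \<open>b\<close> by the braid relation, and \<open>l1\<close> to \<open>l2\<close>.
\<close>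

lemma bracket_23: "map_matrix (bracket R) (l2 \<odot>\<^sub>t l3) = l2 \<leftharpoonup> b - b \<rightharpoonup> l2"
proof -
  have shift_a: "a ** b' ** a' = b' ** a' ** b"
  proof -
    have "a ** b' ** a' = b' ** a' ** (a ** b ** a) ** b' ** a'"
      by (simp add: matrix_mul_assoc cancel_inverses inverses)
    also have "\<dots> = b' ** a' ** b"
      unfolding braid by (simp add: matrix_mul_assoc cancel_inverses)
    finally show ?thesis .
  qed
  have "map_matrix (bracket R) (l2 \<odot>\<^sub>t l3) =
      (a ** b) \<rightharpoonup> l1 \<leftharpoonup> (a ** b' ** a') - (a ** b ** a) \<rightharpoonup> l1 \<leftharpoonup> (b' ** a')"
    unfolding value_23[OF lin_bracket]
    by (simp only: bracket_F op12_diff op12_left op12_right left_diff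
        right_diff left_assoc left_right right_assoc matrix_mul_assoc)
  also have "\<dots> = ((a ** b) \<rightharpoonup> l1 \<leftharpoonup> (b' ** a')) \<leftharpoonup> b - b \<rightharpoonup> ((a ** b) \<rightharpoonup> l1 \<leftharpoonup> (b' ** a'))"
    by (simp only: shift_a braid left_assoc left_right right_assoc matrix_mul_assoc)
  finally show ?thesis
    by (simp only: flip: l2_shift)
qed

lemma R_End_12: "map_matrix (R_End R) (l1 \<odot>\<^sub>t l2) = l2 \<odot>\<^sub>t l1"
  by (simp only: value_12[OF lin_R_End] R_End_F op12_dot)

lemma R_End_13: "map_matrix (R_End R) (l1 \<odot>\<^sub>t l3) = l3 \<odot>\<^sub>t l1"
proof -
  have "map_matrix (R_End R) (l1 \<odot>\<^sub>t l3) = l3 \<odot>\<^sub>t (b \<rightharpoonup> l1 \<leftharpoonup> b')"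
    by (simp only: value_13[OF lin_R_End] R_End_F op12_dot dot_conj inverses)
  then show ?thesis by (simp only: flip: l1_eq)
qed

lemma R_End_23: "map_matrix (R_End R) (l2 \<odot>\<^sub>t l3) = l3 \<odot>\<^sub>t l2"
proof -
  have "map_matrix (R_End R) (l2 \<odot>\<^sub>t l3) =
      ((a ** b) \<rightharpoonup> l2 \<leftharpoonup> (b' ** a')) \<odot>\<^sub>t ((a ** b) \<rightharpoonup> l1 \<leftharpoonup> (b' ** a'))"
    by (simp only: value_23[OF lin_R_End] R_End_F op12_dot dot_conj shift_inverse)
  then show ?thesis by (simp only: flip: l2_shift l3_shift)
qed

lemma map_R_End12:
  "map_matrix (\<lambda>x. R_End12 R x) (M \<odot>\<^sub>t N \<odot>\<^sub>t K) =
    map_matrix assoc (map_matrix (R_End R) (M \<odot>\<^sub>t N) \<odot>\<^sub>t K)"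
  by (simp only: o_def map_dot_left[OF lin_R_End] flip: map_matrix_compose)

lemma lin_brackets:
  "lin (bracket12 R :: _ \<Rightarrow> 'a^(_ \<times> 'd::finite))" "lin (bracket23 R :: 'a^('d \<times> _) \<Rightarrow> _)"
  "lin (R_End23 R :: 'a^('d \<times> _) \<Rightarrow> _)"  "lin (\<lambda>x. R_End12 R (x :: 'a^(_ \<times> _ \<times> 'd)))"
  by (simp_all add: lin_map_left lin_map_right lin_bracket lin_R_End o_def
      lin_compose[OF lin_assoc])

text \<open>
  Both sides take \<open>l1 \<otimes> l2 \<otimes> l3\<close> to the commutator of \<open>l2 \<otimes> l1\<close> with \<open>b\<close>.
\<close>

lemma R_End_bracket23: "R_End R \<circ> bracket23 R = bracket12 R \<circ> R_End23 R \<circ> R_End12 R"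
proof -
  have "map_matrix (\<lambda>x. R_End R (bracket23 R x)) (l1 \<odot>\<^sub>t l2 \<odot>\<^sub>t l3) =
      map_matrix (R_End R) (l1 \<odot>\<^sub>t (l2 \<leftharpoonup> b - b \<rightharpoonup> l2))"
    by (simp only: map_dot_right lin_bracket bracket_23 flip: map_matrix_compose)
  also have "\<dots> = map_matrix (R_End R) ((l1 \<odot>\<^sub>t l2) \<leftharpoonup> b - b \<rightharpoonup> (l1 \<odot>\<^sub>t l2))"
    by (simp only: dot_commutator_right[OF b_l1])
  also have "\<dots> = (l2 \<odot>\<^sub>t l1) \<leftharpoonup> b - b \<rightharpoonup> (l2 \<odot>\<^sub>t l1)"
    by (simp only: map_matrix_diff map_left_action map_right_action lin_R_End R_End_12)
  also have "\<dots> = (l2 \<leftharpoonup> b - b \<rightharpoonup> l2) \<odot>\<^sub>t l1"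
    by (simp only: dot_commutator_left[OF b_l1])
  also have "\<dots> = map_matrix (\<lambda>x. bracket12 R (R_End23 R (R_End12 R x))) (l1 \<odot>\<^sub>t l2 \<odot>\<^sub>t l3)"
  proof -
    have "map_matrix (\<lambda>x. bracket12 R (R_End23 R (R_End12 R x))) (l1 \<odot>\<^sub>t l2 \<odot>\<^sub>t l3) =
        map_matrix (bracket12 R) (map_matrix (R_End23 R)
          (map_matrix (\<lambda>x. R_End12 R x) (l1 \<odot>\<^sub>t l2 \<odot>\<^sub>t l3)))"
      unfolding map_matrix_compose ..
    then show ?thesis
      by (simp only: map_R_End12 R_End_12 map_assoc_dot map_dot_right map_dot_left
          lin_R_End lin_bracket R_End_13 bracket_23)
  qed
  finally have "(\<lambda>x. R_End R (bracket23 R x)) = (\<lambda>x. bracket12 R (R_End23 R (R_End12 R x)))"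
    by (intro ext_triple) (auto intro!: lin_compose[OF lin_R_End lin_brackets(2)]
      lin_compose[OF lin_brackets(1) lin_compose[OF lin_brackets(3,4)]] simp del: o_apply)
  then show ?thesis
    by (simp add: fun_eq_iff)
qed

text \<open>
  Both sides take \<open>l1 \<otimes> l2 \<otimes> l3\<close> to the commutator of \<open>l3 \<otimes> l1\<close> with \<open>a\<close>.
\<close>

lemma R_End_bracket12: "R_End R \<circ> bracket12 R = bracket23 R \<circ> R_End12 R \<circ> R_End23 R"
proof -
  have "map_matrix (\<lambda>x. R_End R (bracket12 R x)) (l1 \<odot>\<^sub>t l2 \<odot>\<^sub>t l3) =
      map_matrix (R_End R) ((l1 \<leftharpoonup> a - a \<rightharpoonup> l1) \<odot>\<^sub>t l3)"
    by (simp only: map_dot_left lin_bracket bracket_12 flip: map_matrix_compose)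
  also have "\<dots> = map_matrix (R_End R) ((l1 \<odot>\<^sub>t l3) \<leftharpoonup> a - a \<rightharpoonup> (l1 \<odot>\<^sub>t l3))"
    by (simp only: dot_commutator_left[OF a_l3])
  also have "\<dots> = (l3 \<odot>\<^sub>t l1) \<leftharpoonup> a - a \<rightharpoonup> (l3 \<odot>\<^sub>t l1)"
    by (simp only: map_matrix_diff map_left_action map_right_action lin_R_End R_End_13)
  also have "\<dots> = l3 \<odot>\<^sub>t (l1 \<leftharpoonup> a - a \<rightharpoonup> l1)"
    by (simp only: dot_commutator_right[OF a_l3])
  also have "\<dots> = map_matrix (\<lambda>x. bracket23 R (R_End12 R (R_End23 R x))) (l1 \<odot>\<^sub>t l2 \<odot>\<^sub>t l3)"
  proof -
    have "map_matrix (\<lambda>x. bracket23 R (R_End12 R (R_End23 R x))) (l1 \<odot>\<^sub>t l2 \<odot>\<^sub>t l3) =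
        map_matrix (bracket23 R) (map_matrix (\<lambda>x. R_End12 R x)
          (map_matrix (R_End23 R) (l1 \<odot>\<^sub>t l2 \<odot>\<^sub>t l3)))"
      unfolding map_matrix_compose ..
    then show ?thesis
      by (simp only: map_R_End12 R_End_13 R_End_23 map_assoc_dot map_dot_right
          lin_R_End lin_bracket bracket_12)
  qed
  finally have "(\<lambda>x. R_End R (bracket12 R x)) = (\<lambda>x. bracket23 R (R_End12 R (R_End23 R x)))"
    by (intro ext_triple) (auto intro!: lin_compose[OF lin_R_End lin_brackets(1)]
      lin_compose[OF lin_brackets(2) lin_compose[OF lin_brackets(4,3)]] simp del: o_apply)
  then show ?thesis
    by (simp add: fun_eq_iff)
qed

end

section \<open>Skew-symmetry and the Jacobi identity\<close>

locale hecke_braiding = braiding R \<Psi>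
  for R \<Psi> :: "'a::field^('n::finite \<times> 'n)^('n \<times> 'n)" +
  fixes q :: 'a
  assumes q_nonzero: "q \<noteq> 0"
    and hecke: "(R - mat q) ** (R + mat (inverse q)) = 0"
begin

text \<open>
  By the Hecke relation, \<open>R\<close> and its inverse differ by this scalar.
\<close>

abbreviation "\<kappa> \<equiv> q - inverse q"

lemma R_square: "R ** R = mat 1 + mat \<kappa> ** R"
proof -
  have "R ** R = mat 1 + (mat q ** R - mat (inverse q) ** R)"
    using hecke q_nonzero
    by (simp add: matrix_add_ldistrib matrix_diff_rdistrib mat_mult_mat algebra_simps
        flip: mat_commutes[of _ R])
  then show ?thesis
    by (simp only: matrix_diff_rdistrib flip: mat_diff)
qed

lemma matrix_inv_R: "matrix_inv R = R - mat \<kappa>"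
proof -
  have "R ** (R - mat \<kappa>) = mat 1"
    by (simp add: matrix_diff_ldistrib R_square flip: mat_commutes[of _ R])
  then have "matrix_inv R ** R ** (R - mat \<kappa>) = matrix_inv R"
    by (simp flip: matrix_mul_assoc)
  then show ?thesis
    by (simp add: matrix_inv_works[OF invertible_R])
qed

text \<open>
  If the eigenvalues \<open>q\<close> and \<open>- inverse q\<close> of \<open>R\<close> are distinct, a commutator with \<open>R\<close> maps each
  eigenspace into the other one, and the product of the two eigenvalues is \<open>-1\<close>. The formula for \<open>R\<^sup>2\<close> gives the identity
  uniformly.
\<close>

lemma commutator_twist:
  "R \<rightharpoonup> (M \<leftharpoonup> R - R \<rightharpoonup> M) \<leftharpoonup> R = R \<rightharpoonup> M - M \<leftharpoonup> R"
proof -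
  have "R \<rightharpoonup> (M \<leftharpoonup> R - R \<rightharpoonup> M) \<leftharpoonup> R = R \<rightharpoonup> M \<leftharpoonup> (R ** R) - (R ** R) \<rightharpoonup> M \<leftharpoonup> R"
    by (simp add: left_diff right_diff left_assoc left_right right_assoc)
  also have "\<dots> = R \<rightharpoonup> M - M \<leftharpoonup> R"
    unfolding R_square
    by (simp add: add_left_action add_right_action left_add right_add left_one right_one left_right
        left_assoc right_mat flip: right_assoc)
  finally show ?thesis .
qed

lemma square_sum: "R ** R + matrix_inv R ** matrix_inv R = mat (q\<^sup>2 + (inverse q)\<^sup>2)"
proof -
  have "R ** R + matrix_inv R ** matrix_inv R = mat 1 + mat 1 + mat (\<kappa> * \<kappa>)"
    unfolding matrix_inv_R
    by (simp add: matrix_diff_ldistrib matrix_diff_rdistrib mat_mult_mat R_square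
        flip: mat_commutes[of _ R])
  also have "\<dots> = mat (1 + 1 + \<kappa> * \<kappa>)"
    by (simp only: mat_add)
  also have "1 + 1 + \<kappa> * \<kappa> = q\<^sup>2 + (inverse q)\<^sup>2"
    using q_nonzero by (simp add: power2_eq_square algebra_simps)
  finally show ?thesis .
qed

text \<open>
  On the values \<open>B\<close> of the bracket, \<open>Q\<close> and its inverse act as conjugations by \<open>R\<close>. By \<open>commutator_twist\<close>
  these are left multiplications by \<open>- R\<^sup>-\<^sup>2\<close> and \<open>- R\<^sup>2\<close>, whose sum cancels the scalar term of \<open>S_op\<close>
  by \<open>square_sum\<close>.
\<close>

lemma bracket_S_op: "bracket R (S_op q R t) = 0"
proof -
  obtain Q' where Q': "lin Q'" "inv_into UNIV (Q_op R) = Q'"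
    "map_matrix Q' F = R \<rightharpoonup> F \<leftharpoonup> matrix_inv R"
    by (rule Q_inverse)
  let ?B = "L1 \<leftharpoonup> R - R \<rightharpoonup> L1 :: ('a^('n \<times> 'n))^('n \<times> 'n)^('n \<times> 'n)"
  have twist: "R \<rightharpoonup> ?B \<leftharpoonup> R = - ?B"
    by (simp only: commutator_twist minus_diff_eq)
  note inv = matrix_inv_works[OF invertible_R]
  have "?B \<leftharpoonup> R = - (matrix_inv R \<rightharpoonup> ?B)"
  proof -
    have "matrix_inv R \<rightharpoonup> (R \<rightharpoonup> ?B \<leftharpoonup> R) = ?B \<leftharpoonup> R"
      by (simp only: left_assoc inv left_one left_right)
    then show ?thesis
      unfolding twist left_minus by (rule sym)
  qed
  then have left: "matrix_inv R \<rightharpoonup> ?B \<leftharpoonup> R = - ((matrix_inv R ** matrix_inv R) \<rightharpoonup> ?B)"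
    by (simp only: left_right left_assoc left_minus)
  have "?B \<leftharpoonup> matrix_inv R = - (R \<rightharpoonup> ?B)"
  proof -
    have "- (R \<rightharpoonup> ?B) = - ((R \<rightharpoonup> ?B \<leftharpoonup> R) \<leftharpoonup> matrix_inv R)"
      by (simp only: right_assoc inv right_one)
    then show ?thesis
      by (simp only: twist right_minus minus_minus)
  qed
  then have right: "R \<rightharpoonup> ?B \<leftharpoonup> matrix_inv R = - ((R ** R) \<rightharpoonup> ?B)"
    by (simp only: left_right left_assoc left_minus)
  have "map_matrix (\<lambda>x. (q\<^sup>2 + (inverse q)\<^sup>2) *s bracket R x + bracket R (Q_op R x) + bracket R (Q' x)) F =
      mat (q\<^sup>2 + (inverse q)\<^sup>2) \<rightharpoonup> map_matrix (bracket R) F + map_matrix (bracket R) (map_matrix (Q_op R) F)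
        + map_matrix (bracket R) (map_matrix Q' F)"
    by (rule matrix_eqI) (simp add: mat_left_entry)
  also have "\<dots> = 0"
    unfolding Q_F Q'(3) map_left_action[OF lin_bracket] map_right_action[OF lin_bracket] bracket_F
      left right square_sum[symmetric] add_left_action by simp
  finally have "(\<lambda>x. (q\<^sup>2 + (inverse q)\<^sup>2) *s bracket R x + bracket R (Q_op R x) + bracket R (Q' x)) = (\<lambda>x. 0)"
    by (intro ext_pair linI) (simp_all add: linD[OF lin_bracket] linD[OF lin_Q] linD[OF Q'(1)]
        vec_eq_iff algebra_simps)
  then have "(q\<^sup>2 + (inverse q)\<^sup>2) *s bracket R t + bracket R (Q_op R t) + bracket R (Q' t) = 0"
    by (rule fun_cong)
  then show ?thesis
    by (simp only: S_op_def linD[OF lin_bracket] Q'(2) vec.scale_zero_right)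
qed

lemma op_square: "a ** a = mat 1 + mat \<kappa> ** a" "b ** b = mat 1 + mat \<kappa> ** b"
proof -
  have "op12 (R ** R) = mat 1 + mat \<kappa> ** a" "op23 (R ** R) = mat 1 + mat \<kappa> ** b"
    unfolding R_square by (simp_all only: op12_add op23_add op12_mult op23_mult op12_mat op23_mat)
  then show "a ** a = mat 1 + mat \<kappa> ** a" "b ** b = mat 1 + mat \<kappa> ** b"
    by (simp_all only: op12_mult op23_mult)
qed

lemma inverse_formulas: "a' = a - mat \<kappa>" "b' = b - mat \<kappa>"
  by (simp_all only: matrix_inv_R op12_diff op23_diff op12_mat op23_mat)

text \<open>
  The values of the two sides of the Jacobi identity on \<open>l1 \<otimes> l2 \<otimes> l3\<close>. Here \<open>\<beta>\<close> is the bracket of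
  \<open>l1\<close> and \<open>l2\<close>. Every term is a word \<open>w P S\<close>, that is, \<open>l1\<close> between a left factor \<open>P\<close> and a right
  factor \<open>S\<close>, and a letter \<open>b\<close> may pass from \<open>P\<close> to \<open>S\<close>. After the braid relation has been used, the
  words that remain are compared by replacing the inverses with \<open>a - \<kappa>\<close> and \<open>b - \<kappa>\<close>
  and the squares with \<open>1 + \<kappa> a\<close> and \<open>1 + \<kappa> b\<close>.
\<close>

lemma jacobi_matrix:
  fixes \<beta>
  defines "\<beta> \<equiv> l1 \<leftharpoonup> a - a \<rightharpoonup> l1"
  shows "(\<beta> \<leftharpoonup> b - b \<rightharpoonup> \<beta>) - a' \<rightharpoonup> (\<beta> \<leftharpoonup> b - b \<rightharpoonup> \<beta>) \<leftharpoonup> a =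
    (b \<rightharpoonup> \<beta> \<leftharpoonup> b') \<leftharpoonup> a - a \<rightharpoonup> (b \<rightharpoonup> \<beta> \<leftharpoonup> b')"
proof -
  define w where "w P S = P \<rightharpoonup> l1 \<leftharpoonup> S" for P S :: "'a^('n \<times> 'n \<times> 'n)^('n \<times> 'n \<times> 'n)"
  define z where "z M = mat \<kappa> \<rightharpoonup> M" for M :: "('a^('n \<times> 'n))^('n \<times> 'n \<times> 'n)^('n \<times> 'n \<times> 'n)"
  have w_b: "w (P ** b) S = w P (b ** S)" for P S
    by (simp only: w_def b_l1 left_right right_assoc flip: left_assoc)
  have w_b1: "w b S = w (mat 1) (b ** S)" for S
    using w_b[of "mat 1" S] by simp
  have w_b': "w P (b' ** S) = w (P ** b') S" for P S
    using w_b[of "P ** b'" "b' ** S"] by (simp add: cancel_inverses inverses matrix_mul_assoc)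
  have w_lin: "w (P + P') S = w P S + w P' S" "w (P - P') S = w P S - w P' S"
    "w P (S + S') = w P S + w P S'" "w P (S - S') = w P S - w P S'" for P P' S S'
    by (simp_all add: w_def add_left_action diff_left_action add_right_action diff_right_action
        left_add left_diff right_add right_diff)
  have w_left_mat: "w (mat \<kappa> ** P) S = z (w P S)" for P S
    by (simp only: w_def z_def left_right flip: left_assoc)
  have w_right_mat: "w P (mat \<kappa> ** S) = z (w P S)" for P S
    by (simp only: w_def z_def right_mat left_right left_assoc mat_commutes flip: right_assoc)
  have actions: "A \<rightharpoonup> w P S = w (A ** P) S" "w P S \<leftharpoonup> A = w P (S ** A)" for A P S
    by (simp_all add: w_def left_right left_assoc right_assoc)
  have \<beta>: "\<beta> = w (mat 1) a - w a (mat 1)"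
    by (simp add: \<beta>_def w_def left_one right_one)
  have a'ba: "a' ** b ** a = b ** a ** b'"
  proof -
    have "a' ** b ** a = a' ** (b ** a ** b) ** b'"
      by (simp add: matrix_mul_assoc cancel_inverses)
    then show ?thesis
      by (simp add: matrix_mul_assoc inverses flip: braid)
  qed

  have "(\<beta> \<leftharpoonup> b - b \<rightharpoonup> \<beta>) - a' \<rightharpoonup> (\<beta> \<leftharpoonup> b - b \<rightharpoonup> \<beta>) \<leftharpoonup> a =
      w (mat 1) (a ** b) - w a b - w b a + w (b ** a) (mat 1)
      - (w a' (a ** b ** a) - w (mat 1) (b ** a) - w (a' ** b) (a ** a) + w (a' ** b ** a) a)"
    by (simp add: \<beta> left_diff right_diff left_add right_add actions inverses matrix_mul_assoc)
  also have "w b a = w (mat 1) (b ** a)"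
    by (rule w_b1)
  also have "w a' (a ** b ** a) = w (a' ** b) (a ** b)"
    by (simp only: braid w_b matrix_mul_assoc)
  also have "w (a' ** b ** a) a = w (b ** a) (b' ** a)"
    by (simp only: a'ba w_b')
  finally have lhs: "(\<beta> \<leftharpoonup> b - b \<rightharpoonup> \<beta>) - a' \<rightharpoonup> (\<beta> \<leftharpoonup> b - b \<rightharpoonup> \<beta>) \<leftharpoonup> a =
      w (mat 1) (a ** b) - w a b + w (b ** a) (mat 1) - w (a' ** b) (a ** b)
      + w (a' ** b) (a ** a) - w (b ** a) (b' ** a)"
    by simp

  have "(b \<rightharpoonup> \<beta> \<leftharpoonup> b') \<leftharpoonup> a - a \<rightharpoonup> (b \<rightharpoonup> \<beta> \<leftharpoonup> b') =
      w b (a ** b' ** a) - w (b ** a) (b' ** a) - (w (a ** b) (a ** b') - w (a ** b ** a) b')"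
    by (simp add: \<beta> left_diff right_diff left_add right_add actions inverses matrix_mul_assoc)
  also have "w (a ** b ** a) b' = w (b ** a) (mat 1)"
    by (simp only: braid w_b inverses)
  finally have rhs: "(b \<rightharpoonup> \<beta> \<leftharpoonup> b') \<leftharpoonup> a - a \<rightharpoonup> (b \<rightharpoonup> \<beta> \<leftharpoonup> b') =
      w b (a ** b' ** a) - w (b ** a) (b' ** a) - w (a ** b) (a ** b') + w (b ** a) (mat 1)"
    by simp

  have a'b: "w (a' ** b) S = w (a ** b) S - z (w b S)" for S
    by (simp only: inverse_formulas matrix_diff_rdistrib w_lin w_left_mat)
  have aa: "w P (a ** a) = w P (mat 1) + z (w P a)" for P
    by (simp only: op_square w_lin w_right_mat)
  have "a ** b' ** a = b ** a ** b - mat \<kappa> ** (a ** a)"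
    by (simp only: inverse_formulas matrix_diff_ldistrib matrix_diff_rdistrib braid matrix_mul_assoc
        flip: mat_commutes[of _ a])
  then have "w b (a ** b' ** a) = w b (b ** a ** b) - z (w b (a ** a))"
    by (simp only: w_lin w_right_mat)
  also have "w b (b ** a ** b) = w (mat 1) (a ** b) + z (w b (a ** b))"
    by (simp only: w_lin w_left_mat op_square flip: w_b matrix_mul_assoc)
  finally have bab: "w b (a ** b' ** a) = w (mat 1) (a ** b) + z (w b (a ** b)) - z (w b (a ** a))" .
  have abab: "w (a ** b) (a ** b') = w (a ** b) (a ** b) - z (w (a ** b) a)"
    by (simp only: inverse_formulas matrix_diff_ldistrib w_lin w_right_mat flip: mat_commutes)
  have ab: "w (a ** b) (mat 1) = w a b"
    by (simp add: w_b)
  show ?thesis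
    unfolding lhs rhs a'b bab abab aa[of "a ** b"] ab by simp
qed

text \<open>
  Since \<open>l3\<close> commutes with \<open>a\<close>, the operator \<open>Q\<close> on the first two factors conjugates all of
  \<open>l1 \<otimes> l2 \<otimes> l3\<close> by \<open>a\<close>, which produces the left-hand side of \<open>jacobi_matrix\<close>. On the other side,
  \<open>l3\<close> passes through the commutator \<open>\<beta>\<close> and meets \<open>l1\<close>.
\<close>

lemma jacobi_tensor:
  "bracket R (bracket23 R (assoc (map_left (\<lambda>t. t - Q_op R t) x))) = bracket R (bracket12 R x)"
proof -
  let ?D = "\<lambda>t. t - Q_op R t"
  let ?Y = "l1 \<odot>\<^sub>t l2 \<odot>\<^sub>t l3"
  let ?\<beta> = "l1 \<leftharpoonup> a - a \<rightharpoonup> l1"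
  have D: "lin ?D"
    by (intro lin_diff lin_id lin_Q)
  have "map_matrix (\<lambda>x. assoc (map_left ?D x)) ?Y = map_matrix assoc (map_matrix ?D (l1 \<odot>\<^sub>t l2) \<odot>\<^sub>t l3)"
    by (simp only: map_dot_left[OF D] flip: map_matrix_compose)
  also have "map_matrix ?D (l1 \<odot>\<^sub>t l2) = l1 \<odot>\<^sub>t l2 - map_matrix (Q_op R) (l1 \<odot>\<^sub>t l2)"
    by (rule matrix_eqI) simp
  also have "map_matrix (Q_op R) (l1 \<odot>\<^sub>t l2) = a' \<rightharpoonup> (l1 \<odot>\<^sub>t l2) \<leftharpoonup> a"
    by (simp only: value_12[OF lin_Q] Q_F op12_left op12_right op12_dot)
  also have "(l1 \<odot>\<^sub>t l2 - a' \<rightharpoonup> (l1 \<odot>\<^sub>t l2) \<leftharpoonup> a) \<odot>\<^sub>t l3 =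
      (l1 \<odot>\<^sub>t l2) \<odot>\<^sub>t l3 - a' \<rightharpoonup> ((l1 \<odot>\<^sub>t l2) \<odot>\<^sub>t l3) \<leftharpoonup> a"
    unfolding dot_diff_left dot_middle a_l3 unfolding dot_left dot_right[of _ l3] ..
  also have "map_matrix assoc \<dots> = ?Y - a' \<rightharpoonup> ?Y \<leftharpoonup> a"
    by (simp only: map_matrix_diff map_left_action map_right_action lin_assoc map_assoc_dot)
  finally have D_Y: "map_matrix (\<lambda>x. assoc (map_left ?D x)) ?Y = ?Y - a' \<rightharpoonup> ?Y \<leftharpoonup> a" .

  have "map_matrix (bracket R) (map_matrix (bracket23 R) ?Y) =
      map_matrix (bracket R) ((l1 \<odot>\<^sub>t l2) \<leftharpoonup> b - b \<rightharpoonup> (l1 \<odot>\<^sub>t l2))"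
    by (simp only: map_dot_right lin_bracket bracket_23 dot_commutator_right[OF b_l1])
  also have "\<dots> = ?\<beta> \<leftharpoonup> b - b \<rightharpoonup> ?\<beta>"
    by (simp only: map_matrix_diff map_left_action map_right_action lin_bracket bracket_12)
  finally have nested: "map_matrix (bracket R) (map_matrix (bracket23 R) ?Y) = ?\<beta> \<leftharpoonup> b - b \<rightharpoonup> ?\<beta>" .

  have "map_matrix (\<lambda>x. bracket R (bracket23 R (assoc (map_left ?D x)))) ?Y =
      map_matrix (bracket R) (map_matrix (bracket23 R) (map_matrix (\<lambda>x. assoc (map_left ?D x)) ?Y))"
    unfolding map_matrix_compose ..
  also have "\<dots> = (?\<beta> \<leftharpoonup> b - b \<rightharpoonup> ?\<beta>) - a' \<rightharpoonup> (?\<beta> \<leftharpoonup> b - b \<rightharpoonup> ?\<beta>) \<leftharpoonup> a"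
    unfolding D_Y
    by (simp only: map_matrix_diff map_left_action map_right_action lin_bracket lin_brackets(2) nested)
  also have "\<dots> = (b \<rightharpoonup> ?\<beta> \<leftharpoonup> b') \<leftharpoonup> a - a \<rightharpoonup> (b \<rightharpoonup> ?\<beta> \<leftharpoonup> b')"
    by (rule jacobi_matrix)
  also have "\<dots> = map_matrix (bracket R) ((l1 \<odot>\<^sub>t l3) \<leftharpoonup> a - a \<rightharpoonup> (l1 \<odot>\<^sub>t l3))"
    by (simp only: map_matrix_diff map_left_action map_right_action lin_bracket bracket_13)
  also have "\<dots> = map_matrix (\<lambda>x. bracket R (bracket12 R x)) ?Y"
    by (simp only: map_dot_left lin_bracket bracket_12 dot_commutator_left[OF a_l3] flip: map_matrix_compose)
  finally have "(\<lambda>x. bracket R (bracket23 R (assoc (map_left ?D x)))) = (\<lambda>x. bracket R (bracket12 R x))"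
    by (rule ext_triple[OF lin_compose[OF lin_bracket lin_compose[OF lin_brackets(2)
      lin_compose[OF lin_assoc lin_map_left[OF D]]]] lin_compose[OF lin_bracket lin_brackets(1)]])
  then show ?thesis
    by (rule fun_cong)
qed

lemma jacobi: "bracket R (bracket23 R (assoc ((t - Q_op R t) \<otimes>\<^sub>t z))) = bracket R (bracket R t \<otimes>\<^sub>t z)"
  using jacobi_tensor[of "assoc (t \<otimes>\<^sub>t z)"]
  by (simp only: map_left_assoc_tensor[OF lin_bracket] map_left_assoc_tensor[OF lin_diff[OF lin_id lin_Q]])

end

section \<open>Representations of the free algebra and of its quotients\<close>

fun word_action :: "('g \<Rightarrow> 'v \<Rightarrow> 'v) \<Rightarrow> 'g list \<Rightarrow> 'v \<Rightarrow> 'v" where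
  "word_action \<alpha> [] y = y"
| "word_action \<alpha> (g # w) y = \<alpha> g (word_action \<alpha> w y)"

definition free_action ::
    "('g \<Rightarrow> 'a::field^'w::finite \<Rightarrow> 'a^'w) \<Rightarrow> ('a, 'g) free_alg \<Rightarrow> 'a^'w \<Rightarrow> 'a^'w" where
  "free_action \<alpha> x y =
    (\<Sum>w\<in>Poly_Mapping.keys x. Poly_Mapping.lookup x w *s word_action \<alpha> (letters w) y)"

lemma word_action_append: "word_action \<alpha> (v @ w) y = word_action \<alpha> v (word_action \<alpha> w y)"
  by (induction v) simp_all

lemma free_action_superset:
  assumes "finite K" "Poly_Mapping.keys x \<subseteq> K"
  shows "free_action \<alpha> x y = (\<Sum>w\<in>K. Poly_Mapping.lookup x w *s word_action \<alpha> (letters w) y)"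
  unfolding free_action_def
  by (rule sum.mono_neutral_left[OF assms]) (simp add: in_keys_iff)

lemma free_action_add: "free_action \<alpha> (x + x') y = free_action \<alpha> x y + free_action \<alpha> x' y"
proof -
  let ?K = "Poly_Mapping.keys x \<union> Poly_Mapping.keys x'"
  have "free_action \<alpha> z y = (\<Sum>w\<in>?K. Poly_Mapping.lookup z w *s word_action \<alpha> (letters w) y)"
    if "z = x \<or> z = x' \<or> z = x + x'" for z
    using that Poly_Mapping.keys_add[of x x'] by (intro free_action_superset) auto
  then show ?thesis
    by (simp add: lookup_add vec.scale_left_distrib sum.distrib)
qed

lemma free_action_single:
  "free_action \<alpha> (Poly_Mapping.single w c) y = c *s word_action \<alpha> (letters w) y"
  by (subst free_action_superset[of "{w}"]) (simp_all add: lookup_single)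

lemma free_action_zero: "free_action \<alpha> 0 y = 0"
  by (simp add: free_action_def)

lemma free_action_sum: "free_action \<alpha> (sum f A) y = (\<Sum>i\<in>A. free_action \<alpha> (f i) y)"
  by (induction A rule: infinite_finite_induct) (simp_all add: free_action_zero free_action_add)

lemma free_action_uminus: "free_action \<alpha> (- x) y = - free_action \<alpha> x y"
  using free_action_add[of \<alpha> x "- x" y] by (simp add: free_action_zero eq_neg_iff_add_eq_0 add.commute)

lemma free_action_diff: "free_action \<alpha> (x - x') y = free_action \<alpha> x y - free_action \<alpha> x' y"
  using free_action_add[of \<alpha> x "- x'" y] by (simp add: free_action_uminus)

lemma sum_singles: "x = (\<Sum>w\<in>Poly_Mapping.keys x. Poly_Mapping.single w (Poly_Mapping.lookup x w))"
  for x :: "'k \<Rightarrow>\<^sub>0 'c::comm_monoid_add"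
  by (rule poly_mapping_eqI) (simp add: lookup_sum lookup_single when_def in_keys_iff)

lemma free_action_scalar: "free_action \<alpha> (scalar c) y = c *s y"
  by (simp add: scalar_def free_action_single zero_free_mon_def)

lemma free_action_one: "free_action \<alpha> 1 y = y"
  using free_action_scalar[of \<alpha> 1 y] by (simp add: scalar_def)

lemma free_action_gen: "free_action \<alpha> (gen g) y = \<alpha> g y"
  by (simp add: gen_def free_action_single)

context
  fixes \<alpha> :: "'g \<Rightarrow> 'a::field^'w::finite \<Rightarrow> 'a^'w"
  assumes lin: "\<And>g. lin (\<alpha> g)"
begin

lemma lin_word_action: "lin (word_action \<alpha> w)"
proof (induction w)
  case Nil
  then show ?case by (simp add: lin_id)
next
  case (Cons g w)
  then show ?case by (simp add: lin_compose[OF lin])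
qed

lemma lin_free_action: "lin (free_action \<alpha> x)"
  by (rule linI) (simp_all add: free_action_def linD[OF lin_word_action] vec.scale_right_distrib
      sum.distrib vec_scale_sum mult.commute)

lemma free_action_mult: "free_action \<alpha> (x * x') y = free_action \<alpha> x (free_action \<alpha> x' y)"
proof -
  let ?s = "\<lambda>x w. Poly_Mapping.single w (Poly_Mapping.lookup x w)"
  have "free_action \<alpha> (x * x') y = free_action \<alpha> ((\<Sum>v\<in>Poly_Mapping.keys x. ?s x v) * (\<Sum>w\<in>Poly_Mapping.keys x'. ?s x' w)) y"
    by (simp only: flip: sum_singles)
  also have "\<dots> = (\<Sum>v\<in>Poly_Mapping.keys x. \<Sum>w\<in>Poly_Mapping.keys x'.
      (Poly_Mapping.lookup x v * Poly_Mapping.lookup x' w) *s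
        word_action \<alpha> (letters v) (word_action \<alpha> (letters w) y))"
    by (simp only: sum_product free_action_sum mult_single free_action_single plus_free_mon_def
        free_mon.sel word_action_append)
  also have "\<dots> = free_action \<alpha> x (free_action \<alpha> x' y)"
    by (simp add: free_action_def linD[OF lin_word_action] vec_scale_sum)
  finally show ?thesis .
qed

end

lemma ring_free_alg: "ring (free_alg_ring :: ('a::field, 'g) free_alg ring)"
proof (rule ringI)
  show "abelian_group (free_alg_ring :: ('a, 'g) free_alg ring)"
    by (rule abelian_groupI) (auto simp: free_alg_ring_def algebra_simps intro: exI[of _ "- _"])
  show "monoid (free_alg_ring :: ('a, 'g) free_alg ring)"
    by (rule monoidI) (simp_all add: free_alg_ring_def mult.assoc)
qed (simp_all add: free_alg_ring_def algebra_simps)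

lemma ring_End: "ring (End_ring :: ('a::field^'w::finite \<Rightarrow> 'a^'w) ring)"
proof (rule ringI)
  show "abelian_group (End_ring :: ('a^'w \<Rightarrow> 'a^'w) ring)"
  proof (rule abelian_groupI)
    fix f :: "'a^'w \<Rightarrow> 'a^'w"
    assume "f \<in> carrier End_ring"
    then have "lin (\<lambda>x. - f x)"
      by (intro linI) (simp_all add: End_ring_def linD)
    then show "\<exists>g\<in>carrier End_ring. g \<oplus>\<^bsub>End_ring\<^esub> f = \<zero>\<^bsub>End_ring\<^esub>"
      by (intro bexI[of _ "\<lambda>x. - f x"]) (simp_all add: End_ring_def)
  qed (auto simp: End_ring_def fun_eq_iff linD algebra_simps vec.scale_right_distrib intro!: linI)
  show "monoid (End_ring :: ('a^'w \<Rightarrow> 'a^'w) ring)"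
    by (rule monoidI) (auto simp: End_ring_def fun_eq_iff linD intro!: linI)
qed (auto simp: End_ring_def fun_eq_iff linD)

lemma free_action_hom:
  assumes "\<And>g. lin (\<alpha> g)"
  shows "free_action \<alpha> \<in> ring_hom free_alg_ring End_ring"
  by (rule ring_hom_memI)
    (auto simp: free_alg_ring_def End_ring_def fun_eq_iff lin_free_action[OF assms]
      free_action_mult[OF assms] free_action_add free_action_one)

text \<open>
  The universal property of a quotient ring, for an ideal that may be smaller than the kernel.
\<close>

lemma hom_factors_through_quotient:
  assumes "ring A" "ring S" "ideal I A" "h \<in> ring_hom A S"
    and vanish: "\<And>x. x \<in> I \<Longrightarrow> h x = \<zero>\<^bsub>S\<^esub>"
  shows "\<exists>\<rho> \<in> ring_hom (A Quot I) S. \<forall>x \<in> carrier A. \<rho> (I +>\<^bsub>A\<^esub> x) = h x"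
proof -
  interpret ideal I A by fact
  interpret S: ring S by fact
  define \<rho> where "\<rho> C = the_elem (h ` C)" for C
  have \<rho>: "\<rho> (I +>\<^bsub>A\<^esub> x) = h x" if x: "x \<in> carrier A" for x
  proof -
    have "h y = h x" if "y \<in> I +>\<^bsub>A\<^esub> x" for y
    proof -
      from that obtain i where i: "i \<in> I" "y = i \<oplus>\<^bsub>A\<^esub> x"
        by (auto simp: a_r_coset_def r_coset_def)
      then have "h y = h i \<oplus>\<^bsub>S\<^esub> h x"
        using x ring_hom_add[OF assms(4)] a_Hcarr by simp
      then show ?thesis
        using vanish[OF i(1)] ring_hom_closed[OF assms(4) x] by simp
    qed
    then have "h ` (I +>\<^bsub>A\<^esub> x) = {h x}"
      using a_rcos_self[OF x] by blast
    then show ?thesis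
      by (simp add: \<rho>_def)
  qed
  have "\<rho> \<in> ring_hom (A Quot I) S"
  proof (rule ring_hom_memI)
    fix C assume "C \<in> carrier (A Quot I)"
    then obtain x where x: "x \<in> carrier A" "C = I +>\<^bsub>A\<^esub> x"
      by (auto simp: FactRing_simps)
    then show "\<rho> C \<in> carrier S"
      using \<rho> ring_hom_closed[OF assms(4)] by simp
    fix D assume "D \<in> carrier (A Quot I)"
    then obtain y where y: "y \<in> carrier A" "D = I +>\<^bsub>A\<^esub> y"
      by (auto simp: FactRing_simps)
    show "\<rho> (C \<otimes>\<^bsub>A Quot I\<^esub> D) = \<rho> C \<otimes>\<^bsub>S\<^esub> \<rho> D"
      using x y ring_hom_mult[OF assms(4)] by (simp add: FactRing_def rcoset_mult_add \<rho>)
    show "\<rho> (C \<oplus>\<^bsub>A Quot I\<^esub> D) = \<rho> C \<oplus>\<^bsub>S\<^esub> \<rho> D"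
      using x y ring_hom_add[OF assms(4)] by (simp add: FactRing_def a_rcos_sum \<rho>)
  next
    show "\<rho> \<one>\<^bsub>A Quot I\<^esub> = \<one>\<^bsub>S\<^esub>"
      using ring_hom_one[OF assms(4)] by (simp add: FactRing_def \<rho>)
  qed
  with \<rho> show ?thesis by blast
qed

text \<open>
  The action of the free algebra is a ring homomorphism. If it kills the entries of the defect, its kernel
  is an ideal that contains the ideal they generate.
\<close>

lemma representation_from_relations:
  fixes \<alpha> :: "'n::finite \<times> 'n \<Rightarrow> 'a::field^'w::finite \<Rightarrow> 'a^'w"
  assumes lin: "\<And>g. lin (\<alpha> g)"
    and relations: "\<And>x y v. free_action \<alpha> (mrea_defect R $ x $ y) v = 0"
  obtains \<rho> where "is_representation R \<rho>" "\<And>g. \<rho> (mrea_class R (gen g)) = \<alpha> g"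
proof -
  let ?A = "free_alg_ring :: ('a, 'n \<times> 'n) free_alg ring"
  let ?S = "End_ring :: ('a^'w \<Rightarrow> 'a^'w) ring"
  have carrier: "carrier ?A = UNIV" and zero: "\<zero>\<^bsub>?S\<^esub> = (\<lambda>_. 0)"
    by (simp_all add: free_alg_ring_def End_ring_def)
  have hom: "ring_hom_ring ?A ?S (free_action \<alpha>)"
    by (rule ring_hom_ringI2[OF ring_free_alg ring_End free_action_hom[OF lin]])
  have kernel: "a_kernel ?A ?S (free_action \<alpha>) = {x. \<forall>v. free_action \<alpha> x v = 0}"
    by (simp add: a_kernel_def' carrier zero fun_eq_iff)
  have "mrea_ideal R \<subseteq> a_kernel ?A ?S (free_action \<alpha>)"
    unfolding mrea_ideal_def
    by (rule ring.genideal_minimal[OF ring_free_alg ring_hom_ring.kernel_is_ideal[OF hom]])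
      (use relations in \<open>auto simp only: kernel\<close>)
  then have vanish: "free_action \<alpha> x = \<zero>\<^bsub>?S\<^esub>" if "x \<in> mrea_ideal R" for x
    using that by (auto simp: kernel zero)
  have ideal: "ideal (mrea_ideal R) ?A"
    unfolding mrea_ideal_def by (rule ring.genideal_ideal[OF ring_free_alg]) (simp add: carrier)
  have "\<exists>\<rho> \<in> ring_hom (?A Quot mrea_ideal R) ?S.
      \<forall>x \<in> carrier ?A. \<rho> (mrea_ideal R +>\<^bsub>?A\<^esub> x) = free_action \<alpha> x"
    by (rule hom_factors_through_quotient[OF ring_free_alg ring_End ideal free_action_hom[OF lin]])
      (rule vanish)
  then obtain \<rho> where hom_\<rho>: "\<rho> \<in> ring_hom (?A Quot mrea_ideal R) ?S"
    and \<rho>: "\<rho> (mrea_class R x) = free_action \<alpha> x" for x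
    unfolding carrier mrea_class_def by blast
  have "is_representation R \<rho>"
    using hom_\<rho> by (simp add: is_representation_def mrea_def \<rho> fun_eq_iff free_action_scalar)
  moreover have "\<rho> (mrea_class R (gen g)) = \<alpha> g" for g
    by (simp add: \<rho> fun_eq_iff free_action_gen)
  ultimately show thesis
    by (rule that)
qed

section \<open>The adjoint representation\<close>

context hecke_braiding
begin

definition ad :: "'n \<times> 'n \<Rightarrow> 'a^('n \<times> 'n) \<Rightarrow> 'a^('n \<times> 'n)" where
  "ad g v = bracket R (axis g 1 \<otimes>\<^sub>t v)"

abbreviation gens :: "(('a, 'n \<times> 'n) free_alg)^('n \<times> 'n)^('n \<times> 'n)" where
  "gens \<equiv> ext_id (\<chi> i j. gen (i, j))"

abbreviation R_scalars :: "(('a, 'n \<times> 'n) free_alg)^('n \<times> 'n)^('n \<times> 'n)" where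
  "R_scalars \<equiv> map_matrix scalar R"

lemma lin_ad: "lin (ad g)"
  unfolding ad_def by (rule lin_compose[OF lin_bracket lin_tensor_right])

lemma ad_gens: "free_action ad (gens $ x $ y) v = bracket R (L1 $ x $ y \<otimes>\<^sub>t v)"
  by (simp add: ext_id_def L1_def L_mat_def free_action_gen free_action_zero ad_def
      tensor_zero_left linD[OF lin_bracket])

lemma action_scalars_left:
  "map_matrix (\<lambda>z. free_action ad z v) (R_scalars ** Z) =
    R \<rightharpoonup> map_matrix (\<lambda>z. free_action ad z v) Z"
  by (rule matrix_eqI) (simp add: matrix_matrix_mult_def mult_num_left_def free_action_sum
      free_action_mult[OF lin_ad] free_action_scalar)

lemma action_scalars_right:
  "map_matrix (\<lambda>z. free_action ad z v) (Z ** R_scalars) =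
    map_matrix (\<lambda>z. free_action ad z v) Z \<leftharpoonup> R"
  by (rule matrix_eqI) (simp add: matrix_matrix_mult_def mult_num_right_def free_action_sum
      free_action_mult[OF lin_ad] free_action_scalar linD[OF lin_free_action[OF lin_ad]])

lemma action_diff:
  "map_matrix (\<lambda>z. free_action ad z v) (Z - Z') =
    map_matrix (\<lambda>z. free_action ad z v) Z - map_matrix (\<lambda>z. free_action ad z v) Z'"
  by (rule matrix_eqI) (simp add: free_action_diff)

lemma lin_ad2: "lin (\<lambda>t. bracket R (bracket23 R (assoc (t \<otimes>\<^sub>t v))))"
  by (rule lin_compose[OF lin_bracket lin_compose[OF lin_brackets(2)
    lin_compose[OF lin_assoc lin_tensor_left]]])

text \<open>
  The quadratic part of the defining relation acts through \<open>L1 R \<otimes> L1\<close>, which is \<open>F\<close> up to a right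
  multiplication by \<open>R\<close>; this is how the values of the bracket on \<open>F\<close> enter.
\<close>

lemma action_quadratic:
  "map_matrix (\<lambda>z. free_action ad z v) (gens ** (R_scalars ** gens)) =
    map_matrix (\<lambda>t. bracket R (bracket23 R (assoc (t \<otimes>\<^sub>t v)))) F \<leftharpoonup> R"
proof -
  have nested: "bracket R (bracket23 R (assoc ((s \<otimes>\<^sub>t t) \<otimes>\<^sub>t v))) = bracket R (s \<otimes>\<^sub>t bracket R (t \<otimes>\<^sub>t v))"
    for s t
    by (simp only: assoc_tensor map_right_tensor[OF lin_bracket])
  have "map_matrix (\<lambda>z. free_action ad z v) (gens ** (R_scalars ** gens)) =
      map_matrix (\<lambda>t. bracket R (bracket23 R (assoc (t \<otimes>\<^sub>t v)))) (L1 \<odot>\<^sub>t (R \<rightharpoonup> L1))"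
    by (rule matrix_eqI)
      (simp add: matrix_matrix_mult_def dot_tensor_def mult_num_left_def linD[OF lin_ad2]
        linD[OF lin_bracket] tensor_sum_right tensor_scale_right nested free_action_sum free_action_mult[OF lin_ad]
        free_action_scalar ad_gens linD[OF lin_free_action[OF lin_ad]])
  also have "\<dots> = map_matrix (\<lambda>t. bracket R (bracket23 R (assoc (t \<otimes>\<^sub>t v)))) F \<leftharpoonup> R"
    by (simp only: map_right_action[OF lin_ad2] flip: F_R)
  finally show ?thesis .
qed

text \<open>
  Write \<open>A1\<close> and \<open>A2\<close> for the matrices of results of acting on \<open>v\<close> by one entry of \<open>L1\<close> and by the products
  encoded in \<open>F\<close>. The Jacobi identity for \<open>F\<close> is \<open>A2 - R\<^sup>-\<^sup>1 A2 R = A1 R - R A1\<close>. Multiplying by \<open>R\<close> on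
  both sides turns the left-hand side into the quadratic part of the relation, and the right-hand side,
  by \<open>commutator_twist\<close>, into its linear part.
\<close>

lemma ad_kills_defect: "free_action ad (mrea_defect R $ x $ y) v = 0"
proof -
  let ?\<Phi> = "map_matrix (\<lambda>z. free_action ad z v)"
  let ?ad1 = "\<lambda>t. bracket R (t \<otimes>\<^sub>t v)"
  let ?ad2 = "\<lambda>t. bracket R (bracket23 R (assoc (t \<otimes>\<^sub>t v)))"
  define A1 where "A1 = map_matrix ?ad1 L1"
  define A2 where "A2 = map_matrix ?ad2 F"
  have ad1: "lin ?ad1"
    by (rule lin_compose[OF lin_bracket lin_tensor_left])

  \<comment> \<open>The Jacobi identity with last argument \<open>v\<close>, evaluated on the entries of \<open>F\<close>.\<close>
  have "A2 - matrix_inv R \<rightharpoonup> A2 \<leftharpoonup> R = map_matrix ?ad2 (F - map_matrix (Q_op R) F)"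
    by (simp only: A2_def Q_F map_matrix_diff map_left_action map_right_action lin_ad2)
  also have "\<dots> = map_matrix ?ad1 (map_matrix (bracket R) F)"
    by (rule matrix_eqI) (simp add: jacobi)
  also have "\<dots> = A1 \<leftharpoonup> R - R \<rightharpoonup> A1"
    by (simp only: bracket_F A1_def map_matrix_diff map_left_action map_right_action ad1)
  finally have jac: "A2 - matrix_inv R \<rightharpoonup> A2 \<leftharpoonup> R = A1 \<leftharpoonup> R - R \<rightharpoonup> A1" .
  have "R \<rightharpoonup> A2 \<leftharpoonup> R - A2 \<leftharpoonup> R \<leftharpoonup> R = R \<rightharpoonup> (A2 - matrix_inv R \<rightharpoonup> A2 \<leftharpoonup> R) \<leftharpoonup> R"
    by (simp add: left_diff right_diff left_assoc left_right right_assoc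
        matrix_inv_works[OF invertible_R] left_one)
  also have "\<dots> = R \<rightharpoonup> A1 - A1 \<leftharpoonup> R"
    unfolding jac by (rule commutator_twist)
  finally have quadratic: "R \<rightharpoonup> A2 \<leftharpoonup> R - A2 \<leftharpoonup> R \<leftharpoonup> R = R \<rightharpoonup> A1 - A1 \<leftharpoonup> R" .

  have linear: "?\<Phi> gens = A1"
    by (rule matrix_eqI) (simp add: ad_gens A1_def)
  have "mrea_defect R = (R_scalars ** (gens ** (R_scalars ** gens)) -
      (gens ** (R_scalars ** gens)) ** R_scalars) - (R_scalars ** gens - gens ** R_scalars)"
    by (simp add: mrea_defect_def Let_def matrix_mul_assoc)
  then have "?\<Phi> (mrea_defect R) = (R \<rightharpoonup> A2 \<leftharpoonup> R - A2 \<leftharpoonup> R \<leftharpoonup> R) - (R \<rightharpoonup> A1 - A1 \<leftharpoonup> R)"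
    by (simp only: action_diff action_scalars_left action_scalars_right action_quadratic linear
        left_right flip: A2_def)
  then have "?\<Phi> (mrea_defect R) $ x $ y = 0"
    unfolding quadratic by simp
  then show ?thesis by simp
qed

lemma adjoint_representation:
  "\<exists>\<rho>. is_representation R \<rho> \<and>
    (\<forall>i j. \<rho> (mrea_class R (gen (i, j))) = (\<lambda>Y. bracket R (L_mat $ i $ j \<otimes>\<^sub>t Y)))"
proof -
  obtain \<rho> where "is_representation R \<rho>" "\<And>g. \<rho> (mrea_class R (gen g)) = ad g"
    using representation_from_relations[OF lin_ad ad_kills_defect] by blast
  then show ?thesis
    by (intro exI[of _ \<rho>]) (simp add: fun_eq_iff ad_def L_mat_def)
qed

end

theorem theorem17:
  fixes q :: "'a::real_normed_field"
    and R :: "'a^('n::finite \<times> 'n)^('n \<times> 'n)"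
  assumes "hecke_symmetry q R"
    and "skew_invertible R"
  shows "(\<forall>t. bracket R (S_op q R t) = 0)
    \<and> (\<forall>X Y Z. bracket R (bracket23 R (assoc ((X \<otimes>\<^sub>t Y - Q_op R (X \<otimes>\<^sub>t Y)) \<otimes>\<^sub>t Z)))
          = bracket R (bracket R (X \<otimes>\<^sub>t Y) \<otimes>\<^sub>t Z))
    \<and> (\<exists>\<rho>. is_representation R \<rho>
          \<and> (\<forall>i j. \<rho> (mrea_class R (gen (i, j))) = (\<lambda>Y. bracket R (L_mat $ i $ j \<otimes>\<^sub>t Y))))
    \<and> R_End R \<circ> bracket23 R = bracket12 R \<circ> R_End23 R \<circ> R_End12 R
    \<and> R_End R \<circ> bracket12 R = bracket23 R \<circ> R_End12 R \<circ> R_End23 R"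
proof -
  obtain \<Psi> where "ptrace2 (op12 R ** op23 \<Psi>) = flip_matrix" "ptrace2 (op12 \<Psi> ** op23 R) = flip_matrix"
    using assms(2) unfolding skew_invertible_def by blast
  then interpret hecke_braiding R \<Psi> q
    using assms(1) by unfold_locales (auto simp: hecke_symmetry_def)
  show ?thesis
    using bracket_S_op jacobi adjoint_representation R_End_bracket23 R_End_bracket12 by blast
qed

end
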